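(* Given inputs $\epsilon>0$, $\alpha\in(0,1)$ and an impedance-defining capacity vector $\hat x^{br}$ (held fixed), the bundle method with interleaved contingency generation (the algorithm described in the context, started at some $x_1\in\mathcal X$) terminates in finitely many iterations and returns an $\epsilon$-optimal solution $x^*$ (together with operational decisions $y^*$) of the problem $$\text{(BUND)}\qquad \min_{x\in\mathcal X}\ F(x):=c^\top x+\sum_{\omega\in\Omega}h^r(\hat x^{br},x,\xi_\omega,\mathcal J^{full}).$$ Here $\epsilon$-optimal is meant in the relative sense of the algorithm's stopping rule: $x^*\in\mathcal X$ and $F(x^* )-\min_{x\in\mathcal X}F(x)\le \epsilon\,F(x^* )$.
   Context: NETWORK AND FIRST-STAGE DATA. A connected network has $N$ nodes, $b$ AC branches and $\beta$ HVDC lines; $[n]=\{1,\dots,n\}$; $\odot$ is the elementwise product; $\mathbf 1$ is an all-ones vector. $A^{br}\in\{-1,0,1\}^{N\times b}$ is the branch incidence matrix: the column of branch $j$ has entry $+1$ at its (arbitrarily assigned) "from" bus and $-1$ at its "to" bus. $A^{dc}\in\{-1,0,1\}^{N\times\beta}$ is the HVDC incidence matrix. $\Omega=\{1,\dots,|\Omega|\}$ is the finite set of weekly scenarios, each with $T$ hours. The first-stage vector is $x=(x^g,x^{esp},x^{ese},x^{br},x^{inv},x^{em})$: new generator capacities $x^g\in\mathbb R^{n^g}$, storage power and energy capacities $x^{esp},x^{ese}\in\mathbb R^{n^{es}}$, AC branch capacity upgrades $x^{br}\in\mathbb R^b$, reservoir states $x^{inv}_\omega\in\mathbb R^{|\mathcal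 G^{hy}|}$ at the start of each week for the set $\mathcal G^{hy}$ of reservoir clusters (with $x^{inv}_{|\Omega|+1}=x^{inv}_1$), and policy budgets $x^{em}\in\mathbb R^{|\Omega|}$. The feasible set is the polytope $\mathcal X=\{x:0\le x\le\overline x,\ \mathbf 1^\top x^{em}\le\overline x^{em}\}$ (with given bounds $\overline x$, whose reservoir part is $\overline x^{inv}$, and given policy goal $\overline x^{em}$), and $c$ is the investment cost vector. $\overline w^{g},\overline w^{esp},\overline w^{ese},\overline w^{br},\overline w^{dc},\overline w^{hy}$ denote existing capacities of generators, storage power, storage energy, AC branches, HVDC lines and hydro units. Scenario data are $\xi_\omega=[c^g_\omega,a^g_\omega,\overline p^d_\omega]$ (generator operating costs, availability factors, load levels). IMPEDANCES AND CONTINGENCIES. $\chi_j(x^{br}_j)=\chi^0_j\overline w^{br}_j/(\overline w^{br}_j+x^{br}_j)$ is the impedance of branch $j$, where $\chi^0_j$ is its original impedance. $B(x^{br})=\mathrm{diag}(\chi(x^{br}))^{-1}$; $A\in\mathbb R^{b\times(N-1)}$ is $(A^{br})^\top$ with the slack bus column removed; $\Phi(x^{br})=B(x^{br})A[A^\top B(x^{br})A]^{-1}$; $\Lambda(x^{br})=\Phi(x^{br})A^\top[I-\mathrm{diag}(\Phi(x^{br})A^\top)]^{-1}$, where $\mathrm{diag}$ of a matrix keeps its diagonal part (only the columns $j\in\mathcal B$ are used). $\mathcal B\subseteq[b]$ is the set of non-bridge (non-islanding) branches. $\mathcal J^{full}=\{(t,i,j)\in[T]\times[b]\times\mathcal B:i\ne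 j\}$. $D\in\{-1,0,1\}^{n^c\times b}$, $n^c=b-N+1$, is a directed cycle basis matrix of the network. OPERATIONAL FEASIBLE SET. For $\hat x^{br}$, $x$, $\xi_\omega$ and $\mathcal J_\omega\subseteq\mathcal J^{full}$, the set $\mathcal Y^r(\hat x^{br},x,\xi_\omega,\mathcal J_\omega)$ consists of all vectors $y_\omega$ of operational decisions satisfying, for all $t\in[T]$ (subscript $\omega$ is suppressed on operational variables): - Generators (power $p^g_t$, reserves $r^g_t$, ramp rates $R$, emissions factors $e$): $p^g_t+r^g_t\le a^g_{\omega t}\odot(\overline w^g+x^g)$; $-R\odot(\overline w^g+x^g)\le p^g_{t+1}-p^g_t\le R\odot(\overline w^g+x^g)$ with $p^g_{T+1}:=p^g_1$; $\sum_{t\in[T]}e^\top p^g_t\le x^{em}_\omega$; $p^g_t,r^g_t\ge0$. - Storage (net output $p^{es}_t$, charging $p^{chg}_t$, discharging $p^{dis}_t$, reserves $r^{dis}_t$, state of charge $q_t$, efficiency $\eta^{es}$): $p^{es}_t=p^{dis}_t-p^{chg}_t$; $p^{chg}_t+p^{dis}_t+r^{dis}_t\le\overline w^{esp}+x^{esp}$; $q_t\le\overline w^{ese}+x^{ese}$; $q_t-r^{dis}_t\ge0$; $q_{t+1}=q_t+p^{chg}_t\eta^{es}-p^{dis}_t/\eta^{es}$; $q_1=q_{T+1}$; $q_t,p^{chg}_t,p^{dis}_t,r^{dis}_t\ge0$. - Reserves (margin $\gamma^d$): $\mathbf 1^\top r^g_t+\mathbf 1^\top r^{dis}_t\ge\gamma^d\mathbf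 1^\top\overline p^d_{\omega t}$. - Unit commitment (set $\mathcal G^{uc}$ of clusters, 0-1 assignment matrix $A^{uc}\in\{0,1\}^{|\mathcal G^{uc}|\times n^g}$, nominal unit capacities $\Delta^{uc}$, relaxed unit counts $z^{uc}$, commitment, startup and shutdown variables $u_t,s^{uc}_t,d^{uc}_t$, minimum-power parameters $\mu^{min\text{-}uc}$, minimum up and down times $m^s_{\mathfrak c},m^d_{\mathfrak c}$): $\Delta^{uc}\odot z^{uc}=A^{uc}(\overline w^g+x^g)$; $0\le u_t,s^{uc}_t,d^{uc}_t\le z^{uc}$; $A^{uc}p^g_t\ge\mu^{min\text{-}uc}\odot\Delta^{uc}\odot u_t$; $A^{uc}(p^g_t+r^g_t)\le\Delta^{uc}\odot u_t$; $u_{t+1}=u_t+s^{uc}_t-d^{uc}_t$; $u_{t\mathfrak c}\ge\sum_{\tau=\max(1,t-m^s_{\mathfrak c})}^t s^{uc}_{\tau\mathfrak c}$ and $z^{uc}_{\mathfrak c}-u_{t\mathfrak c}\ge\sum_{\tau=\max(1,t-m^d_{\mathfrak c})}^t d^{uc}_{\tau\mathfrak c}$ for $\mathfrak c\in\mathcal G^{uc}$; $u_1=u_{T+1}$. - Hydro ($p^{hy}_t$ is the hydro part of $p^g_t$, $q^{hy}_t$ are reservoir levels, the 0-1 matrix $A^{hy}$ assigns hydro units to reservoir clusters, $\mu^{min\text{-}hy}_{\omega t}$ and $\overline\rho^{hy}_{\omega t}$ are minimum-generation and inflow parameters): $p^{hy}_t\ge\mu^{min\text{-}hy}_{\omega t}\odot\overline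 w^{hy}$; $q^{hy}_{t+1}\le q^{hy}_t+A^{hy}(\overline\rho^{hy}_{\omega t}\odot\overline w^{hy}-p^{hy}_t)$; $0\le q^{hy}_t\le\overline x^{inv}$ for $t\in[T+1]$; $q^{hy}_1=x^{inv}_\omega$, $q^{hy}_{T+1}=x^{inv}_{\omega+1}$. - Power balance (net injections $p^{ni}_t$, AC branch flows $p^{br}_t$, HVDC flows $p^{dc}_t$, load shedding $p^{sh}_t\ge0$, 0-1 incidence matrices $A^g,A^{es},A^d$ of generators, storage and loads): $p^{ni}_t=A^gp^g_t+A^{es}p^{es}_t-A^{dc}p^{dc}_t-A^d(\overline p^d_{\omega t}-p^{sh}_t)$; $p^{ni}_t=A^{br}p^{br}_t$. - Base-case limits: $-(\overline w^{br}+x^{br})\le p^{br}_t\le\overline w^{br}+x^{br}$; $-\overline w^{dc}\le p^{dc}_t\le\overline w^{dc}$. - Kirchhoff's voltage law with impedances fixed at $\hat x^{br}$: $\sum_{j}D_{\kappa j}\chi_j(\hat x^{br}_j)p^{br}_{tj}=0$ for all $\kappa\in[n^c]$. - Contingencies, for $(t,i,j)\in\mathcal J_\omega$ (post-contingency flows $p^{brc}_{tij}$, slacks $s^c_{tij}$): $p^{brc}_{tij}=p^{br}_{ti}+\Lambda_{ij}(\hat x^{br})p^{br}_{tj}$; $-\eta^c(\overline w^{br}_i+x^{br}_i)-s^c_{tij}\le p^{brc}_{tij}\le\eta^c(\overline w^{br}_i+x^{br}_i)+s^c_{tij}$; $s^c_{tij}\ge0$; where $\eta^c\ge1$ is a scalar.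 The paper asserts complete recourse: $\mathcal Y^r$ is nonempty for any $x$. VALUE FUNCTION. $h^r(\hat x^{br},x,\xi_\omega,\mathcal J_\omega)=\min\{z_\omega^\top y_\omega:y_\omega\in\mathcal Y^r(\hat x^{br},x,\xi_\omega,\mathcal J_\omega)\}$, where $z_\omega^\top y_\omega=\sum_{t=1}^T[(c^g_{\omega t})^\top p^g_t+(c^{uc})^\top s^{uc}_t+c^{sh}\mathbf 1^\top p^{sh}_t+c^{vio}\mathbf 1^\top s^c_t]$, with $c^{uc}$ the vector of startup costs, $c^{sh},c^{vio}$ scalar penalty coefficients, and $\mathbf 1^\top s^c_t$ the sum of the slacks at time $t$ over the contingencies in $\mathcal J_\omega$. ORACLE. $\mathcal O(\hat x^{br},x,\xi_\omega,\mathcal J_\omega)$ returns $(y^*_\omega,\theta^*_\omega,g^*_\omega,\sigma^c_\omega,\mathcal J'_\omega)$ with: $y^*_\omega$ a minimizer of the problem defining $h^r(\hat x^{br},x,\xi_\omega,\mathcal J_\omega)$; $\theta^*_\omega=z_\omega^\top y^*_\omega$; $g^*_\omega\in\partial_xh^r(\hat x^{br},x,\xi_\omega,\mathcal J_\omega)$; $\hat s^c_{\omega tij}=[\,|p^{br}_{\omega ti}+\Lambda_{ij}(\hat x^{br})p^{br}_{\omega tj}|-\eta^c(\overline w^{br}_i+x^{br}_i)]^+$ with $p^{br}$ from $y^*_\omega$ and $[\cdot]^+=\max\{\cdot,0\}$; $\mathcal J'_\omega=\{(t,i,j)\in\mathcal J^{full}\setminus\mathcal J_\omega:\hat s^c_{\omega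 tij}>0\}$; $\sigma^c_\omega=c^{vio}\sum_{(t,i,j)\in\mathcal J'_\omega}\hat s^c_{\omega tij}$. ANALYTIC CENTER. $ac(\mathcal Z)=\arg\max_{x\in\mathcal Z}\Psi(x)$ is the analytic center of a convex set $\mathcal Z$, where $\Psi$ is a self-concordant barrier of $\mathcal Z$. ALGORITHM (bundle method with interleaved contingencies). Initialize $L_0=0$, $U_0=\infty$, some $x_1\in\mathcal X$, $\hat h_{0\omega}\equiv0$ and $\mathcal J_{1\omega}=\emptyset$ for all $\omega$. For $k=1,2,\dots$: 1. For every $\omega\in\Omega$: $(y_{k\omega},\theta_{k\omega},g_{k\omega},\sigma_{k\omega},\mathcal J'_{k\omega})\leftarrow\mathcal O(\hat x^{br},x_k,\xi_\omega,\mathcal J_{k\omega})$; $\hat h_{k\omega}(x)\leftarrow\max\{\hat h_{k-1,\omega}(x),\theta_{k\omega}+g_{k\omega}^\top(x-x_k)\}$; $\mathcal J_{k+1,\omega}\leftarrow\mathcal J_{k\omega}\cup\mathcal J'_{k\omega}$. 2. $\hat f_k(x)\leftarrow c^\top x+\sum_\omega\hat h_{k\omega}(x)$; $f_k\leftarrow c^\top x_k+\sum_\omega[\theta_{k\omega}+\sigma_{k\omega}]$; $L_k\leftarrow\min_{x\in\mathcal X}\hat f_k(x)$; $U_k\leftarrow\min\{U_{k-1},f_k\}$. 3. If $U_k=f_k$, set $x^*\leftarrow x_k$, $y^*\leftarrow\{y_{k\omega}\}_\omega$. 4. If $(U_k-L_k)/U_k<\epsilon$, return $x^*,y^*$ and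 stop. 5. $\theta^{lev}_k\leftarrow L_k+\alpha(U_k-L_k)$; $x_{k+1}\leftarrow ac(\{x\in\mathcal X:\hat f_k(x)\le\theta^{lev}_k\})$.
   Formalization: The formal theorem adds that operating, startup and penalty costs are nonnegative (so that the initial model 0 is a valid lower bound) and that F(x) > 0 for all x in X (so that the relative gap and relative ε-optimality make sense). *)

theory Defs
  imports "HOL-Analysis.Analysis"
begin

text \<open>
  Index types: \<open>'n option\<close> buses (\<open>None\<close> is the slack bus), \<open>'br\<close> AC branches, \<open>'dc\<close> HVDC lines,
  \<open>'g\<close> generators, \<open>'es\<close> storage units, \<open>'ld\<close> loads, \<open>'uc\<close> unit-commitment clusters,
  \<open>'hy\<close> reservoir clusters, \<open>'hu\<close> hydro units, \<open>'w\<close> scenarios (weeks).  Hours are natural numbers,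
  \<open>1..T\<close>.  On \<open>real ^ 'i\<close> the library's \<open>*\<close>, \<open>\<le>\<close> and \<open>1\<close> are the elementwise product, the
  elementwise order and the all-ones vector.
\<close>

section \<open>Convex analysis\<close>

definition subdifferential :: "('a::real_inner \<Rightarrow> ereal) \<Rightarrow> 'a \<Rightarrow> 'a set" where
  "subdifferential h x =
     {g. \<bar>h x\<bar> \<noteq> \<infinity> \<and> (\<forall>x'. h x + ereal (g \<bullet> (x' - x)) \<le> h x')}"

text \<open>
  The sign is that of a function to be maximised: \<open>- \<Psi>\<close> is a self-concordant barrier in the sense of
  Nesterov and Nemirovskii, taken relative to the affine hull of \<open>Z\<close>, since \<open>Z\<close> may have empty
  interior.  \<open>D\<^sub>1 x d\<close>, \<open>D\<^sub>2 x d\<close>, \<open>D\<^sub>3 x d\<close> are the first three derivatives of \<open>- \<Psi>\<close> at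
  \<open>x\<close> in direction \<open>d\<close>, and \<open>\<nu>\<close> is the barrier parameter.
\<close>

definition self_concordant_barrier :: "'a::euclidean_space set \<Rightarrow> ('a \<Rightarrow> real) \<Rightarrow> bool" where
  "self_concordant_barrier Z \<Psi> \<longleftrightarrow>
     continuous_on (rel_interior Z) \<Psi> \<and>
     (\<forall>u l. (\<forall>n. u n \<in> rel_interior Z) \<and> l \<in> rel_frontier Z \<and> u \<longlonglongrightarrow> l \<longrightarrow>
        filterlim (\<lambda>n. \<Psi> (u n)) at_bot sequentially) \<and>
     (\<exists>D\<^sub>1 D\<^sub>2 D\<^sub>3 :: 'a \<Rightarrow> 'a \<Rightarrow> real. \<exists>\<nu>\<ge>0.
        \<forall>x\<in>rel_interior Z. \<forall>d. x + d \<in> affine hull Z \<longrightarrow>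
          ((\<lambda>s. - \<Psi> (x + s *\<^sub>R d)) has_real_derivative D\<^sub>1 x d) (at 0) \<and>
          ((\<lambda>s. D\<^sub>1 (x + s *\<^sub>R d) d) has_real_derivative D\<^sub>2 x d) (at 0) \<and>
          ((\<lambda>s. D\<^sub>2 (x + s *\<^sub>R d) d) has_real_derivative D\<^sub>3 x d) (at 0) \<and>
          continuous_on (rel_interior Z) (\<lambda>z. D\<^sub>3 z d) \<and>
          0 \<le> D\<^sub>2 x d \<and>
          \<bar>D\<^sub>3 x d\<bar> \<le> 2 * D\<^sub>2 x d powr (3/2) \<and>
          (D\<^sub>1 x d)\<^sup>2 \<le> \<nu> * D\<^sub>2 x d)"

text \<open>A barrier is \<open>-\<infinity>\<close> on the relative boundary, so the maximum over \<open>Z\<close> is one over its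
  relative interior.\<close>

definition is_analytic_center :: "('a::euclidean_space \<Rightarrow> real) \<Rightarrow> 'a set \<Rightarrow> 'a \<Rightarrow> bool" where
  "is_analytic_center \<Psi> Z x \<longleftrightarrow> is_arg_max \<Psi> (\<lambda>z. z \<in> rel_interior Z) x"

section \<open>First-stage vectors\<close>

text \<open>\<open>x = (x\<^sup>g, x\<^sup>e\<^sup>s\<^sup>p, x\<^sup>e\<^sup>s\<^sup>e, x\<^sup>b\<^sup>r, x\<^sup>i\<^sup>n\<^sup>v, x\<^sup>e\<^sup>m)\<close>\<close>

type_synonym ('g, 'es, 'br, 'hy, 'w) fst_stage =
  "(real^'g) \<times> (real^'es) \<times> (real^'es) \<times> (real^'br) \<times> ((real^'hy)^'w) \<times> (real^'w)"

fun x_g :: "('g,'es,'br,'hy,'w) fst_stage \<Rightarrow> real^'g" where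
  "x_g (g, esp, ese, br, res, em) = g"
fun x_esp :: "('g,'es,'br,'hy,'w) fst_stage \<Rightarrow> real^'es" where
  "x_esp (g, esp, ese, br, res, em) = esp"
fun x_ese :: "('g,'es,'br,'hy,'w) fst_stage \<Rightarrow> real^'es" where
  "x_ese (g, esp, ese, br, res, em) = ese"
fun x_br :: "('g,'es,'br,'hy,'w) fst_stage \<Rightarrow> real^'br" where
  "x_br (g, esp, ese, br, res, em) = br"
fun x_inv :: "('g,'es,'br,'hy,'w) fst_stage \<Rightarrow> (real^'hy)^'w" where
  "x_inv (g, esp, ese, br, res, em) = res"
fun x_em :: "('g,'es,'br,'hy,'w) fst_stage \<Rightarrow> real^'w" where
  "x_em (g, esp, ese, br, res, em) = em"

text \<open>The week after the last one is the first one.\<close>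

definition next_week :: "'w::{finite,linorder} \<Rightarrow> 'w" where
  "next_week w = (if \<exists>v. w < v then Min {v. w < v} else Min UNIV)"

section \<open>Problem data\<close>

record ('n, 'br, 'dc, 'g, 'es, 'ld, 'uc, 'hy, 'hu, 'w) data =
  hours :: nat
  \<comment> \<open>network: end points of branches and HVDC lines, cycle matrix rows, placement of resources\<close>
  fr_br :: "'br \<Rightarrow> 'n option"
  to_br :: "'br \<Rightarrow> 'n option"
  fr_dc :: "'dc \<Rightarrow> 'n option"
  to_dc :: "'dc \<Rightarrow> 'n option"
  cyc :: "nat \<Rightarrow> real^'br"
  imp0 :: "real^'br"
  A_g :: "real^'g^('n option)"
  A_es :: "real^'es^('n option)"
  A_d :: "real^'ld^('n option)"
  A_uc :: "real^'g^'uc"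
  A_hy :: "real^'hu^'hy"
  hydro :: "'hu \<Rightarrow> 'g"
  \<comment> \<open>first-stage cost, upper bounds and policy goal\<close>
  cost_inv :: "('g,'es,'br,'hy,'w) fst_stage"
  xbar_g :: "real^'g"
  xbar_esp :: "real^'es"
  xbar_ese :: "real^'es"
  xbar_br :: "real^'br"
  xbar_inv :: "real^'hy"
  xbar_em :: "real^'w"
  em_goal :: real
  \<comment> \<open>existing capacities\<close>
  w_g :: "real^'g"
  w_esp :: "real^'es"
  w_ese :: "real^'es"
  w_br :: "real^'br"
  w_dc :: "real^'dc"
  w_hy :: "real^'hu"
  \<comment> \<open>scenario data per week and hour\<close>
  c_g :: "'w \<Rightarrow> nat \<Rightarrow> real^'g"
  a_g :: "'w \<Rightarrow> nat \<Rightarrow> real^'g"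
  p_d :: "'w \<Rightarrow> nat \<Rightarrow> real^'ld"
  mu_hy :: "'w \<Rightarrow> nat \<Rightarrow> real^'hu"
  rho_hy :: "'w \<Rightarrow> nat \<Rightarrow> real^'hu"
  \<comment> \<open>operational parameters\<close>
  ramp :: "real^'g"
  emis :: "real^'g"
  eta_es :: real
  gamma_d :: real
  delta_uc :: "real^'uc"
  mu_uc :: "real^'uc"
  min_up :: "'uc \<Rightarrow> nat"
  min_down :: "'uc \<Rightarrow> nat"
  eta_c :: real
  c_uc :: "real^'uc"
  c_sh :: real
  c_vio :: real

definition incidence :: "('j \<Rightarrow> 'i) \<Rightarrow> ('j \<Rightarrow> 'i) \<Rightarrow> real^'j^'i" where
  "incidence fr to = (\<chi> i j. if i = fr j then 1 else if i = to j then - 1 else 0)"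

abbreviation "A_br D \<equiv> incidence (fr_br D) (to_br D)"
abbreviation "A_dc D \<equiv> incidence (fr_dc D) (to_dc D)"

definition connected_via ::
  "('n::finite,'br::finite,'dc::finite,'g::finite,'es::finite,'ld::finite,'uc::finite,'hy::finite,
    'hu::finite,'w::{finite,linorder}) data \<Rightarrow> 'br set \<Rightarrow> bool" where
  "connected_via D S \<longleftrightarrow>
     (\<forall>u v. (u, v) \<in> ({(fr_br D j, to_br D j) | j. j \<in> S} \<union> {(to_br D j, fr_br D j) | j. j \<in> S})\<^sup>*)"

text \<open>In a connected network a branch is a bridge iff its removal disconnects the network.\<close>

definition nonbridges ::
  "('n::finite,'br::finite,'dc::finite,'g::finite,'es::finite,'ld::finite,'uc::finite,'hy::finite,
    'hu::finite,'w::{finite,linorder}) data \<Rightarrow> 'br set" where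
  "nonbridges D = {j. connected_via D (- {j})}"

text \<open>
  \<open>v\<close> is the signed indicator vector of a simple cycle, which is given as the list of its branches
  in order of traversal, each with a flag telling whether it is traversed from its "from" bus to its
  "to" bus.
\<close>

definition is_cycle_vector ::
  "('n::finite,'br::finite,'dc::finite,'g::finite,'es::finite,'ld::finite,'uc::finite,'hy::finite,
    'hu::finite,'w::{finite,linorder}) data \<Rightarrow> real^'br \<Rightarrow> bool" where
  "is_cycle_vector D v \<longleftrightarrow>
     (\<exists>es :: ('br \<times> bool) list.
        let tail = (\<lambda>(j, fwd). if fwd then fr_br D j else to_br D j);
            head = (\<lambda>(j, fwd). if fwd then to_br D j else fr_br D j)
        in es \<noteq> [] \<and> distinct (map fst es) \<and> distinct (map tail es) \<and>
           (\<forall>i<length es. head (es ! i) = tail (es ! (Suc i mod length es))) \<and>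
           v = (\<chi> j. if (j, True) \<in> set es then 1 else if (j, False) \<in> set es then - 1 else 0))"

definition n_cyc ::
  "('n::finite,'br::finite,'dc::finite,'g::finite,'es::finite,'ld::finite,'uc::finite,'hy::finite,
    'hu::finite,'w::{finite,linorder}) data \<Rightarrow> nat" where
  "n_cyc D = CARD('br) + 1 - CARD('n option)"

definition cycle_basis ::
  "('n::finite,'br::finite,'dc::finite,'g::finite,'es::finite,'ld::finite,'uc::finite,'hy::finite,
    'hu::finite,'w::{finite,linorder}) data \<Rightarrow> bool" where
  "cycle_basis D \<longleftrightarrow>
     (\<forall>\<kappa><n_cyc D. is_cycle_vector D (cyc D \<kappa>)) \<and>
     inj_on (cyc D) {..<n_cyc D} \<and> independent (cyc D ` {..<n_cyc D})"

definition zero_one :: "real^'j^'i \<Rightarrow> bool" where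
  "zero_one M \<longleftrightarrow> (\<forall>i j. M $ i $ j \<in> {0, 1})"

definition valid_data ::
  "('n::finite,'br::finite,'dc::finite,'g::finite,'es::finite,'ld::finite,'uc::finite,'hy::finite,
    'hu::finite,'w::{finite,linorder}) data \<Rightarrow> bool" where
  "valid_data D \<longleftrightarrow>
     1 \<le> hours D \<and>
     (\<forall>j. fr_br D j \<noteq> to_br D j) \<and> (\<forall>l. fr_dc D l \<noteq> to_dc D l) \<and>
     connected_via D UNIV \<and> cycle_basis D \<and>
     zero_one (A_g D) \<and> zero_one (A_es D) \<and> zero_one (A_d D) \<and>
     zero_one (A_uc D) \<and> zero_one (A_hy D) \<and> inj (hydro D) \<and>
     1 \<le> eta_c D"

definition nonneg_costs ::
  "('n::finite,'br::finite,'dc::finite,'g::finite,'es::finite,'ld::finite,'uc::finite,'hy::finite,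
    'hu::finite,'w::{finite,linorder}) data \<Rightarrow> bool" where
  "nonneg_costs D \<longleftrightarrow>
     (\<forall>w. \<forall>t\<in>{1..hours D}. 0 \<le> c_g D w t) \<and> 0 \<le> c_uc D \<and> 0 \<le> c_sh D \<and> 0 \<le> c_vio D"

definition xbar ::
  "('n::finite,'br::finite,'dc::finite,'g::finite,'es::finite,'ld::finite,'uc::finite,'hy::finite,
    'hu::finite,'w::{finite,linorder}) data \<Rightarrow> ('g,'es,'br,'hy,'w) fst_stage" where
  "xbar D = (xbar_g D, xbar_esp D, xbar_ese D, xbar_br D, (\<chi> w. xbar_inv D), xbar_em D)"

definition X_set ::
  "('n::finite,'br::finite,'dc::finite,'g::finite,'es::finite,'ld::finite,'uc::finite,'hy::finite,
    'hu::finite,'w::{finite,linorder}) data \<Rightarrow> ('g,'es,'br,'hy,'w) fst_stage set" where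
  "X_set D = {x \<in> cbox 0 (xbar D). 1 \<bullet> x_em x \<le> em_goal D}"

section \<open>Impedances and contingencies\<close>

definition impedance ::
  "('n::finite,'br::finite,'dc::finite,'g::finite,'es::finite,'ld::finite,'uc::finite,'hy::finite,
    'hu::finite,'w::{finite,linorder}) data \<Rightarrow> real^'br \<Rightarrow> real^'br" where
  "impedance D xbr = (\<chi> j. imp0 D $ j * w_br D $ j / (w_br D $ j + xbr $ j))"

definition B_mat ::
  "('n::finite,'br::finite,'dc::finite,'g::finite,'es::finite,'ld::finite,'uc::finite,'hy::finite,
    'hu::finite,'w::{finite,linorder}) data \<Rightarrow> real^'br \<Rightarrow> real^'br^'br" where
  "B_mat D xbr = matrix_inv (\<chi> i j. if i = j then impedance D xbr $ j else 0)"

definition A_red ::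
  "('n::finite,'br::finite,'dc::finite,'g::finite,'es::finite,'ld::finite,'uc::finite,'hy::finite,
    'hu::finite,'w::{finite,linorder}) data \<Rightarrow> real^'n^'br" where
  "A_red D = (\<chi> j n. A_br D $ Some n $ j)"

definition Phi ::
  "('n::finite,'br::finite,'dc::finite,'g::finite,'es::finite,'ld::finite,'uc::finite,'hy::finite,
    'hu::finite,'w::{finite,linorder}) data \<Rightarrow> real^'br \<Rightarrow> real^'n^'br" where
  "Phi D xbr = B_mat D xbr ** A_red D **
     matrix_inv (transpose (A_red D) ** B_mat D xbr ** A_red D)"

text \<open>
  The diagonal factor \<open>[I - diag (\<Phi> A\<^sup>T)]\<^sup>-\<^sup>1\<close> is applied column by column: the diagonal entry of
  a bridge is \<open>1\<close>, so the full matrix is singular as soon as there is a bridge, whereas only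
  columns of non-bridges are used.
\<close>

definition Lambda ::
  "('n::finite,'br::finite,'dc::finite,'g::finite,'es::finite,'ld::finite,'uc::finite,'hy::finite,
    'hu::finite,'w::{finite,linorder}) data \<Rightarrow> real^'br \<Rightarrow> real^'br^'br" where
  "Lambda D xbr =
     (let M = Phi D xbr ** transpose (A_red D) in \<chi> i j. M $ i $ j / (1 - M $ j $ j))"

definition J_full ::
  "('n::finite,'br::finite,'dc::finite,'g::finite,'es::finite,'ld::finite,'uc::finite,'hy::finite,
    'hu::finite,'w::{finite,linorder}) data \<Rightarrow> (nat \<times> 'br \<times> 'br) set" where
  "J_full D = {(t, i, j). t \<in> {1..hours D} \<and> j \<in> nonbridges D \<and> i \<noteq> j}"

section \<open>Operations\<close>

record ('n, 'br, 'dc, 'g, 'es, 'ld, 'uc, 'hy) ops =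
  pg :: "nat \<Rightarrow> real^'g"
  rg :: "nat \<Rightarrow> real^'g"
  pes :: "nat \<Rightarrow> real^'es"
  pchg :: "nat \<Rightarrow> real^'es"
  pdis :: "nat \<Rightarrow> real^'es"
  rdis :: "nat \<Rightarrow> real^'es"
  soc :: "nat \<Rightarrow> real^'es"
  zuc :: "real^'uc"
  commit :: "nat \<Rightarrow> real^'uc"
  startup :: "nat \<Rightarrow> real^'uc"
  shutdown :: "nat \<Rightarrow> real^'uc"
  qhy :: "nat \<Rightarrow> real^'hy"
  pni :: "nat \<Rightarrow> real^('n option)"
  pbr :: "nat \<Rightarrow> real^'br"
  pdc :: "nat \<Rightarrow> real^'dc"
  psh :: "nat \<Rightarrow> real^'ld"
  pbrc :: "nat \<Rightarrow> 'br \<Rightarrow> 'br \<Rightarrow> real"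
  slack :: "nat \<Rightarrow> 'br \<Rightarrow> 'br \<Rightarrow> real"

definition gen_ok ::
  "('n::finite,'br::finite,'dc::finite,'g::finite,'es::finite,'ld::finite,'uc::finite,'hy::finite,
    'hu::finite,'w::{finite,linorder}) data \<Rightarrow> ('g,'es,'br,'hy,'w) fst_stage \<Rightarrow> 'w
    \<Rightarrow> ('n,'br,'dc,'g,'es,'ld,'uc,'hy) ops \<Rightarrow> bool" where
  "gen_ok D x w y \<longleftrightarrow>
     (\<forall>t\<in>{1..hours D}.
        let cap = w_g D + x_g x; p' = (if t = hours D then pg y 1 else pg y (t + 1)) in
        pg y t + rg y t \<le> a_g D w t * cap \<and>
        - (ramp D * cap) \<le> p' - pg y t \<and> p' - pg y t \<le> ramp D * cap \<and>
        0 \<le> pg y t \<and> 0 \<le> rg y t) \<and>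
     (\<Sum>t=1..hours D. emis D \<bullet> pg y t) \<le> x_em x $ w"

definition storage_ok ::
  "('n::finite,'br::finite,'dc::finite,'g::finite,'es::finite,'ld::finite,'uc::finite,'hy::finite,
    'hu::finite,'w::{finite,linorder}) data \<Rightarrow> ('g,'es,'br,'hy,'w) fst_stage
    \<Rightarrow> ('n,'br,'dc,'g,'es,'ld,'uc,'hy) ops \<Rightarrow> bool" where
  "storage_ok D x y \<longleftrightarrow>
     (\<forall>t\<in>{1..hours D}.
        pes y t = pdis y t - pchg y t \<and>
        pchg y t + pdis y t + rdis y t \<le> w_esp D + x_esp x \<and>
        soc y t \<le> w_ese D + x_ese x \<and>
        0 \<le> soc y t - rdis y t \<and>
        soc y (t + 1) = soc y t + eta_es D *\<^sub>R pchg y t - (1 / eta_es D) *\<^sub>R pdis y t \<and>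
        0 \<le> soc y t \<and> 0 \<le> pchg y t \<and> 0 \<le> pdis y t \<and> 0 \<le> rdis y t) \<and>
     soc y 1 = soc y (hours D + 1)"

definition reserve_ok ::
  "('n::finite,'br::finite,'dc::finite,'g::finite,'es::finite,'ld::finite,'uc::finite,'hy::finite,
    'hu::finite,'w::{finite,linorder}) data \<Rightarrow> 'w
    \<Rightarrow> ('n,'br,'dc,'g,'es,'ld,'uc,'hy) ops \<Rightarrow> bool" where
  "reserve_ok D w y \<longleftrightarrow>
     (\<forall>t\<in>{1..hours D}. gamma_d D * (1 \<bullet> p_d D w t) \<le> 1 \<bullet> rg y t + 1 \<bullet> rdis y t)"

definition uc_ok ::
  "('n::finite,'br::finite,'dc::finite,'g::finite,'es::finite,'ld::finite,'uc::finite,'hy::finite,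
    'hu::finite,'w::{finite,linorder}) data \<Rightarrow> ('g,'es,'br,'hy,'w) fst_stage
    \<Rightarrow> ('n,'br,'dc,'g,'es,'ld,'uc,'hy) ops \<Rightarrow> bool" where
  "uc_ok D x y \<longleftrightarrow>
     delta_uc D * zuc y = A_uc D *v (w_g D + x_g x) \<and>
     (\<forall>t\<in>{1..hours D}.
        0 \<le> commit y t \<and> commit y t \<le> zuc y \<and>
        0 \<le> startup y t \<and> startup y t \<le> zuc y \<and>
        0 \<le> shutdown y t \<and> shutdown y t \<le> zuc y \<and>
        mu_uc D * delta_uc D * commit y t \<le> A_uc D *v pg y t \<and>
        A_uc D *v (pg y t + rg y t) \<le> delta_uc D * commit y t \<and>
        commit y (t + 1) = commit y t + startup y t - shutdown y t \<and>
        (\<forall>c. (\<Sum>\<tau>=max 1 (t - min_up D c)..t. startup y \<tau> $ c) \<le> commit y t $ c \<and>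
             (\<Sum>\<tau>=max 1 (t - min_down D c)..t. shutdown y \<tau> $ c) \<le> zuc y $ c - commit y t $ c)) \<and>
     commit y 1 = commit y (hours D + 1)"

definition hydro_ok ::
  "('n::finite,'br::finite,'dc::finite,'g::finite,'es::finite,'ld::finite,'uc::finite,'hy::finite,
    'hu::finite,'w::{finite,linorder}) data \<Rightarrow> ('g,'es,'br,'hy,'w) fst_stage \<Rightarrow> 'w
    \<Rightarrow> ('n,'br,'dc,'g,'es,'ld,'uc,'hy) ops \<Rightarrow> bool" where
  "hydro_ok D x w y \<longleftrightarrow>
     (\<forall>t\<in>{1..hours D}.
        let phy = (\<chi> i. pg y t $ hydro D i) in
        mu_hy D w t * w_hy D \<le> phy \<and>
        qhy y (t + 1) \<le> qhy y t + A_hy D *v (rho_hy D w t * w_hy D - phy)) \<and>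
     (\<forall>t\<in>{1..hours D + 1}. 0 \<le> qhy y t \<and> qhy y t \<le> xbar_inv D) \<and>
     qhy y 1 = x_inv x $ w \<and> qhy y (hours D + 1) = x_inv x $ next_week w"

definition network_ok ::
  "('n::finite,'br::finite,'dc::finite,'g::finite,'es::finite,'ld::finite,'uc::finite,'hy::finite,
    'hu::finite,'w::{finite,linorder}) data \<Rightarrow> real^'br \<Rightarrow> ('g,'es,'br,'hy,'w) fst_stage \<Rightarrow> 'w
    \<Rightarrow> ('n,'br,'dc,'g,'es,'ld,'uc,'hy) ops \<Rightarrow> bool" where
  "network_ok D xhat x w y \<longleftrightarrow>
     (\<forall>t\<in>{1..hours D}.
        0 \<le> psh y t \<and>
        pni y t = A_g D *v pg y t + A_es D *v pes y t - A_dc D *v pdc y t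
                  - A_d D *v (p_d D w t - psh y t) \<and>
        pni y t = A_br D *v pbr y t \<and>
        - (w_br D + x_br x) \<le> pbr y t \<and> pbr y t \<le> w_br D + x_br x \<and>
        - w_dc D \<le> pdc y t \<and> pdc y t \<le> w_dc D \<and>
        (\<forall>\<kappa><n_cyc D. (\<Sum>j\<in>UNIV. cyc D \<kappa> $ j * impedance D xhat $ j * pbr y t $ j) = 0))"

definition contingency_ok ::
  "('n::finite,'br::finite,'dc::finite,'g::finite,'es::finite,'ld::finite,'uc::finite,'hy::finite,
    'hu::finite,'w::{finite,linorder}) data \<Rightarrow> real^'br \<Rightarrow> ('g,'es,'br,'hy,'w) fst_stage
    \<Rightarrow> (nat \<times> 'br \<times> 'br) set \<Rightarrow> ('n,'br,'dc,'g,'es,'ld,'uc,'hy) ops \<Rightarrow> bool" where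
  "contingency_ok D xhat x J y \<longleftrightarrow>
     (\<forall>(t, i, j)\<in>J.
        let lim = eta_c D * (w_br D $ i + x_br x $ i) in
        pbrc y t i j = pbr y t $ i + Lambda D xhat $ i $ j * pbr y t $ j \<and>
        - lim - slack y t i j \<le> pbrc y t i j \<and> pbrc y t i j \<le> lim + slack y t i j \<and>
        0 \<le> slack y t i j)"

definition Y_set ::
  "('n::finite,'br::finite,'dc::finite,'g::finite,'es::finite,'ld::finite,'uc::finite,'hy::finite,
    'hu::finite,'w::{finite,linorder}) data \<Rightarrow> real^'br \<Rightarrow> ('g,'es,'br,'hy,'w) fst_stage \<Rightarrow> 'w
    \<Rightarrow> (nat \<times> 'br \<times> 'br) set \<Rightarrow> ('n,'br,'dc,'g,'es,'ld,'uc,'hy) ops set" where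
  "Y_set D xhat x w J =
     {y. gen_ok D x w y \<and> storage_ok D x y \<and> reserve_ok D w y \<and> uc_ok D x y \<and>
         hydro_ok D x w y \<and> network_ok D xhat x w y \<and> contingency_ok D xhat x J y}"

definition op_cost ::
  "('n::finite,'br::finite,'dc::finite,'g::finite,'es::finite,'ld::finite,'uc::finite,'hy::finite,
    'hu::finite,'w::{finite,linorder}) data \<Rightarrow> 'w \<Rightarrow> (nat \<times> 'br \<times> 'br) set
    \<Rightarrow> ('n,'br,'dc,'g,'es,'ld,'uc,'hy) ops \<Rightarrow> real" where
  "op_cost D w J y =
     (\<Sum>t=1..hours D. c_g D w t \<bullet> pg y t + c_uc D \<bullet> startup y t + c_sh D * (1 \<bullet> psh y t)
        + c_vio D * (\<Sum>(i, j) | (t, i, j) \<in> J. slack y t i j))"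

text \<open>The value is \<open>\<infinity>\<close> where the operational problem is infeasible.\<close>

definition h_r ::
  "('n::finite,'br::finite,'dc::finite,'g::finite,'es::finite,'ld::finite,'uc::finite,'hy::finite,
    'hu::finite,'w::{finite,linorder}) data \<Rightarrow> real^'br \<Rightarrow> ('g,'es,'br,'hy,'w) fst_stage \<Rightarrow> 'w
    \<Rightarrow> (nat \<times> 'br \<times> 'br) set \<Rightarrow> ereal" where
  "h_r D xhat x w J = (INF y\<in>Y_set D xhat x w J. ereal (op_cost D w J y))"

definition complete_recourse ::
  "('n::finite,'br::finite,'dc::finite,'g::finite,'es::finite,'ld::finite,'uc::finite,'hy::finite,
    'hu::finite,'w::{finite,linorder}) data \<Rightarrow> real^'br \<Rightarrow> bool" where
  "complete_recourse D xhat \<longleftrightarrow>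
     (\<forall>x\<in>X_set D. \<forall>w. \<forall>J\<subseteq>J_full D. Y_set D xhat x w J \<noteq> {})"

section \<open>The problem (BUND)\<close>

definition F_obj ::
  "('n::finite,'br::finite,'dc::finite,'g::finite,'es::finite,'ld::finite,'uc::finite,'hy::finite,
    'hu::finite,'w::{finite,linorder}) data \<Rightarrow> real^'br \<Rightarrow> ('g,'es,'br,'hy,'w) fst_stage
    \<Rightarrow> ereal" where
  "F_obj D xhat x = ereal (cost_inv D \<bullet> x) + (\<Sum>w\<in>UNIV. h_r D xhat x w (J_full D))"

definition eps_optimal ::
  "('n::finite,'br::finite,'dc::finite,'g::finite,'es::finite,'ld::finite,'uc::finite,'hy::finite,
    'hu::finite,'w::{finite,linorder}) data \<Rightarrow> real^'br \<Rightarrow> real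
    \<Rightarrow> ('g,'es,'br,'hy,'w) fst_stage \<Rightarrow> bool" where
  "eps_optimal D xhat \<epsilon> x \<longleftrightarrow>
     x \<in> X_set D \<and>
     F_obj D xhat x - (INF x'\<in>X_set D. F_obj D xhat x') \<le> ereal \<epsilon> * F_obj D xhat x"

section \<open>Oracle and bundle method\<close>

definition violation ::
  "('n::finite,'br::finite,'dc::finite,'g::finite,'es::finite,'ld::finite,'uc::finite,'hy::finite,
    'hu::finite,'w::{finite,linorder}) data \<Rightarrow> real^'br \<Rightarrow> ('g,'es,'br,'hy,'w) fst_stage
    \<Rightarrow> ('n,'br,'dc,'g,'es,'ld,'uc,'hy) ops \<Rightarrow> nat \<times> 'br \<times> 'br \<Rightarrow> real" where
  "violation D xhat x y = (\<lambda>(t, i, j).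
     max (\<bar>pbr y t $ i + Lambda D xhat $ i $ j * pbr y t $ j\<bar>
          - eta_c D * (w_br D $ i + x_br x $ i)) 0)"

text \<open>\<open>oracle_rel\<close> relates the inputs to every admissible output \<open>(y, \<theta>, g, \<sigma>, J')\<close>: neither the
  minimiser \<open>y\<close> nor the subgradient \<open>g\<close> need be unique.\<close>

definition oracle_rel ::
  "('n::finite,'br::finite,'dc::finite,'g::finite,'es::finite,'ld::finite,'uc::finite,'hy::finite,
    'hu::finite,'w::{finite,linorder}) data \<Rightarrow> real^'br \<Rightarrow> ('g,'es,'br,'hy,'w) fst_stage \<Rightarrow> 'w
    \<Rightarrow> (nat \<times> 'br \<times> 'br) set
    \<Rightarrow> ('n,'br,'dc,'g,'es,'ld,'uc,'hy) ops \<Rightarrow> real \<Rightarrow> ('g,'es,'br,'hy,'w) fst_stage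
    \<Rightarrow> real \<Rightarrow> (nat \<times> 'br \<times> 'br) set \<Rightarrow> bool" where
  "oracle_rel D xhat x w J y \<theta> g \<sigma> J' \<longleftrightarrow>
     is_arg_min (op_cost D w J) (\<lambda>y. y \<in> Y_set D xhat x w J) y \<and>
     \<theta> = op_cost D w J y \<and>
     g \<in> subdifferential (\<lambda>x. h_r D xhat x w J) x \<and>
     J' = {\<zeta> \<in> J_full D - J. 0 < violation D xhat x y \<zeta>} \<and>
     \<sigma> = c_vio D * (\<Sum>\<zeta>\<in>J'. violation D xhat x y \<zeta>)"

text \<open>
  What iteration \<open>k\<close> starts from: \<open>x\<^sub>k\<close>, the models \<open>h\<^sub>k\<^sub>-\<^sub>1\<close>, the contingency sets \<open>J\<^sub>k\<close>, the upper
  bound \<open>U\<^sub>k\<^sub>-\<^sub>1\<close> and the incumbent \<open>(x\<^sup>*, y\<^sup>*)\<close>, if any.  The lower bound is recomputed in every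
  iteration and is therefore not kept; in particular \<open>L\<^sub>0\<close> is never read.
\<close>

record ('x, 'y, 'w, 'c) bundle_state =
  cur :: 'x
  model :: "'w \<Rightarrow> 'x \<Rightarrow> real"
  conts :: "'w \<Rightarrow> 'c set"
  upper :: ereal
  incumbent :: "('x \<times> ('w \<Rightarrow> 'y)) option"

datatype ('x, 'y, 'w, 'c) config =
    Running "('x, 'y, 'w, 'c) bundle_state"
  | Returned 'x "'w \<Rightarrow> 'y"

definition start :: "'x \<Rightarrow> ('x, 'y, 'w, 'c) config" where
  "start x1 = Running \<lparr>cur = x1, model = (\<lambda>w x. 0), conts = (\<lambda>w. {}), upper = \<infinity>, incumbent = None\<rparr>"

definition f_model ::
  "('n::finite,'br::finite,'dc::finite,'g::finite,'es::finite,'ld::finite,'uc::finite,'hy::finite,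
    'hu::finite,'w::{finite,linorder}) data
    \<Rightarrow> ('w \<Rightarrow> ('g,'es,'br,'hy,'w) fst_stage \<Rightarrow> real) \<Rightarrow> ('g,'es,'br,'hy,'w) fst_stage \<Rightarrow> real" where
  "f_model D h x = cost_inv D \<bullet> x + (\<Sum>w\<in>UNIV. h w x)"

text \<open>
  The common part of an iteration (solving the subproblems, models, bounds, incumbent): from \<open>s\<close> it yields
  the new models \<open>h\<close>, contingency sets \<open>J\<close>, bounds \<open>L\<close>, \<open>U\<close> and incumbent \<open>inc\<close>.
\<close>

definition iteration ::
  "('n::finite,'br::finite,'dc::finite,'g::finite,'es::finite,'ld::finite,'uc::finite,'hy::finite,
    'hu::finite,'w::{finite,linorder}) data \<Rightarrow> real^'br
    \<Rightarrow> (('g,'es,'br,'hy,'w) fst_stage, ('n,'br,'dc,'g,'es,'ld,'uc,'hy) ops, 'w,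
        nat \<times> 'br \<times> 'br) bundle_state
    \<Rightarrow> ('w \<Rightarrow> ('g,'es,'br,'hy,'w) fst_stage \<Rightarrow> real) \<Rightarrow> ('w \<Rightarrow> (nat \<times> 'br \<times> 'br) set)
    \<Rightarrow> real \<Rightarrow> ereal
    \<Rightarrow> (('g,'es,'br,'hy,'w) fst_stage \<times> ('w \<Rightarrow> ('n,'br,'dc,'g,'es,'ld,'uc,'hy) ops)) option
    \<Rightarrow> bool" where
  "iteration D xhat s h J L U inc \<longleftrightarrow>
     (\<exists>y \<theta> g \<sigma> J'.
        (\<forall>w. oracle_rel D xhat (cur s) w (conts s w) (y w) (\<theta> w) (g w) (\<sigma> w) (J' w)) \<and>
        h = (\<lambda>w x. max (model s w x) (\<theta> w + g w \<bullet> (x - cur s))) \<and>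
        J = (\<lambda>w. conts s w \<union> J' w) \<and>
        L = (INF x\<in>X_set D. f_model D h x) \<and>
        (let f = ereal (cost_inv D \<bullet> cur s + (\<Sum>w\<in>UNIV. \<theta> w + \<sigma> w)) in
         U = min (upper s) f \<and>
         inc = (if U = f then Some (cur s, y) else incumbent s)))"

inductive step ::
  "('n::finite,'br::finite,'dc::finite,'g::finite,'es::finite,'ld::finite,'uc::finite,'hy::finite,
    'hu::finite,'w::{finite,linorder}) data \<Rightarrow> real^'br \<Rightarrow> real \<Rightarrow> real
    \<Rightarrow> (('g,'es,'br,'hy,'w) fst_stage set \<Rightarrow> ('g,'es,'br,'hy,'w) fst_stage \<Rightarrow> real)
    \<Rightarrow> (('g,'es,'br,'hy,'w) fst_stage, ('n,'br,'dc,'g,'es,'ld,'uc,'hy) ops, 'w,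
        nat \<times> 'br \<times> 'br) config
    \<Rightarrow> (('g,'es,'br,'hy,'w) fst_stage, ('n,'br,'dc,'g,'es,'ld,'uc,'hy) ops, 'w,
        nat \<times> 'br \<times> 'br) config \<Rightarrow> bool"
  for D xhat \<epsilon> \<alpha> \<Psi> where
  stop:
  "iteration D xhat s h J L U (Some (x, y)) \<Longrightarrow>
   (U - ereal L) / U < ereal \<epsilon> \<Longrightarrow>
   step D xhat \<epsilon> \<alpha> \<Psi> (Running s) (Returned x y)"
| continue:
  "iteration D xhat s h J L U inc \<Longrightarrow>
   \<not> (U - ereal L) / U < ereal \<epsilon> \<Longrightarrow>
   Z = {x \<in> X_set D. ereal (f_model D h x) \<le> ereal L + ereal \<alpha> * (U - ereal L)} \<Longrightarrow>
   is_analytic_center (\<Psi> Z) Z x' \<Longrightarrow>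
   step D xhat \<epsilon> \<alpha> \<Psi> (Running s)
     (Running \<lparr>cur = x', model = h, conts = J, upper = U, incumbent = inc\<rparr>)"

end

theory Submission
  imports Defs
begin

text \<open>
  Every quantity of the algorithm is piecewise affine in \<open>x\<close>.  The set of triples of a first-stage
  vector, a cost bound \<open>r\<close> and operations of cost at most \<open>r\<close> is given by finitely many affine
  inequalities, and eliminating the operations one variable at a time (Fourier--Motzkin,
  \<open>lin_projection\<close>) leaves finitely many affine inequalities in \<open>(x, r)\<close>.  The inequalities in which
  \<open>r\<close> occurs are affine minorants of \<open>h\<^sup>r\<close>, and their maximum is \<open>h\<^sup>r\<close> wherever the week is feasible
  (\<open>value_function_pieces\<close>).  Hence minimisers and subgradients exist, so the oracle always has an
  answer, and \<open>h\<^sup>r\<close> is Lipschitz continuous on \<open>\<X>\<close>.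

  The bounds are valid in every iteration, although the contingency sets are incomplete.  A cut for a
  small set of contingencies lies below the full value function, as adding contingencies only
  raises the cost (\<open>h_r_mono\<close>).  Conversely, operations for a small set become operations for the
  full set if each missing contingency gets its violation as slack, at the extra cost \<open>\<sigma>\<close>
  (\<open>h_r_le_repaired\<close>).  So \<open>L\<^sub>k \<le> min F\<close> and \<open>F x\<^sup>* \<le> U\<^sub>k\<close>, and the stopping test implies
  relative optimality.

  Whenever the test fails, \<open>U\<^sub>k - L\<^sub>k \<ge> \<epsilon> U\<^sub>k \<ge> \<epsilon> min F > 0\<close>.  The level set is then a nonempty
  polytope, and a barrier has a maximiser on it because it tends to \<open>-\<infinity>\<close> at the relative boundary
  (\<open>analytic_center_exists\<close>).  Since the level lies strictly above \<open>L\<^sub>k\<close>, this center lies even in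
  the relative interior of \<open>\<X>\<close> (\<open>sublevel_rel_interior_subset\<close>).

  In an infinite run the contingency sets, growing inside a finite set, are constant from some
  iteration on, and from then on no violation is added to \<open>f\<^sub>i\<close>, which is the value at \<open>x\<^sub>i\<close> of the
  objective with these contingencies.  An arbitrary
  subgradient at the boundary of \<open>\<X>\<close> may be arbitrarily steep, but at a point of the relative
  interior its slope along \<open>\<X>\<close> is bounded by the Lipschitz constant (\<open>cut_slope_bound\<close>).
  For later iterates \<open>x\<^sub>k\<close> the \<open>i\<close>-th cut therefore gives
  \<open>U\<^sub>i - M |x\<^sub>k - x\<^sub>i| \<le> L\<^sub>k\<^sub>-\<^sub>1 + \<alpha> (U\<^sub>k\<^sub>-\<^sub>1 - L\<^sub>k\<^sub>-\<^sub>1)\<close> for a fixed \<open>M\<close>.  As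
  \<open>U\<^sub>i \<ge> U\<^sub>k\<^sub>-\<^sub>1\<close>, the distance of any two of these iterates is at least \<open>(1 - \<alpha>) \<epsilon> min F / M\<close>, which
  is impossible in the compact set \<open>\<X>\<close>.
\<close>

section \<open>Projections of linear systems\<close>

text \<open>Functions that are affine in a parameter \<open>x\<close> and in finitely many of the variables \<open>y v\<close>.  The
  variable type \<open>'v\<close> may be infinite, as the operations are indexed by all natural numbers; the inductive form
  makes both recognising such functions and reasoning about them a matter of rules.\<close>

inductive affine_expr :: "('x::euclidean_space \<Rightarrow> ('v \<Rightarrow> real) \<Rightarrow> real) \<Rightarrow> bool" where
  affine_inner: "affine_expr (\<lambda>x y. a \<bullet> x)"
| affine_var: "affine_expr (\<lambda>x y. y v)"
| affine_const: "affine_expr (\<lambda>x y. c)"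
| affine_add: "affine_expr e \<Longrightarrow> affine_expr e' \<Longrightarrow> affine_expr (\<lambda>x y. e x y + e' x y)"
| affine_scale: "affine_expr e \<Longrightarrow> affine_expr (\<lambda>x y. c * e x y)"

lemma affine_uminus:
  assumes "affine_expr e"
  shows "affine_expr (\<lambda>x y. - e x y)"
  using affine_scale[OF assms, of "- 1"] by simp

lemma affine_diff:
  assumes "affine_expr e" "affine_expr e'"
  shows "affine_expr (\<lambda>x y. e x y - e' x y)"
  using affine_add[OF assms(1) affine_uminus[OF assms(2)]] by simp

lemma affine_sum:
  assumes "\<And>i. i \<in> I \<Longrightarrow> affine_expr (e i)"
  shows "affine_expr (\<lambda>x y. \<Sum>i\<in>I. e i x y)"
  using assms by (induction I rule: infinite_finite_induct) (auto intro: affine_expr.intros)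

lemma affine_divide:
  assumes "affine_expr e"
  shows "affine_expr (\<lambda>x y. e x y / c)"
  using affine_scale[OF assms, of "1 / c"] by simp

lemma affine_linear:
  assumes "linear L"
  shows "affine_expr (\<lambda>x y. L x)"
proof -
  have "L = (\<lambda>x. (\<Sum>b\<in>Basis. L b *\<^sub>R b) \<bullet> x)"
  proof
    fix x
    have "L x = L (\<Sum>b\<in>Basis. (x \<bullet> b) *\<^sub>R b)"
      by (simp add: euclidean_representation)
    also have "\<dots> = (\<Sum>b\<in>Basis. (x \<bullet> b) * L b)"
      by (simp add: linear_sum[OF assms] linear_cmul[OF assms])
    also have "\<dots> = (\<Sum>b\<in>Basis. L b *\<^sub>R b) \<bullet> x"
      by (simp add: inner_sum_left inner_commute[of x] mult.commute)
    finally show "L x = (\<Sum>b\<in>Basis. L b *\<^sub>R b) \<bullet> x" .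
  qed
  then show ?thesis
    using affine_inner by metis
qed

lemma affine_split_variable:
  assumes "affine_expr e"
  shows "\<exists>\<beta> e0. affine_expr e0 \<and> (\<forall>x y t. e x (y(v := t)) = e0 x y + \<beta> * t)"
  using assms
proof induction
  case (affine_inner a)
  show ?case
    by (rule exI[of _ 0], rule exI[of _ "\<lambda>x y. a \<bullet> x"]) (simp add: affine_expr.affine_inner)
next
  case (affine_var u)
  show ?case
  proof (cases "u = v")
    case True
    show ?thesis
      by (rule exI[of _ 1], rule exI[of _ "\<lambda>x y. 0"]) (simp add: affine_expr.affine_const True)
  next
    case False
    show ?thesis
      by (rule exI[of _ 0], rule exI[of _ "\<lambda>x y. y u"]) (simp add: affine_expr.affine_var False)
  qed
next
  case (affine_const c)
  show ?case
    by (rule exI[of _ 0], rule exI[of _ "\<lambda>x y. c"]) (simp add: affine_expr.affine_const)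
next
  case (affine_add e e')
  then obtain \<beta> e0 \<beta>' e0' where
    e: "affine_expr e0" "\<And>x y t. e x (y(v := t)) = e0 x y + \<beta> * t" and
    e': "affine_expr e0'" "\<And>x y t. e' x (y(v := t)) = e0' x y + \<beta>' * t"
    by metis
  show ?case
    by (rule exI[of _ "\<beta> + \<beta>'"], rule exI[of _ "\<lambda>x y. e0 x y + e0' x y"])
      (intro conjI allI affine_expr.affine_add e e', simp only: e e', algebra)
next
  case (affine_scale e c)
  then obtain \<beta> e0 where
    e: "affine_expr e0" "\<And>x y t. e x (y(v := t)) = e0 x y + \<beta> * t"
    by metis
  show ?case
    by (rule exI[of _ "c * \<beta>"], rule exI[of _ "\<lambda>x y. c * e0 x y"])
      (intro conjI allI affine_expr.affine_scale e, simp only: e, algebra)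
qed

lemma affine_finite_support:
  fixes e :: "'x::euclidean_space \<Rightarrow> ('v \<Rightarrow> real) \<Rightarrow> real"
  assumes "affine_expr e"
  shows "\<exists>V. finite V \<and> (\<forall>x y y'. (\<forall>v\<in>V. y v = y' v) \<longrightarrow> e x y = e x y')"
  using assms
proof induction
  case (affine_var v)
  show ?case by (rule exI[of _ "{v}"]) simp
next
  case (affine_add e e')
  from affine_add.IH obtain V V' where V: "finite V"
    "\<forall>x y y'. (\<forall>v\<in>V. y v = y' v) \<longrightarrow> e x y = e x y'"
    and V': "finite V'" "\<forall>x y y'. (\<forall>v\<in>V'. y v = y' v) \<longrightarrow> e' x y = e' x y'"
    by blast
  show ?case
  proof (intro exI[of _ "V \<union> V'"] conjI allI impI)
    fix x and y y' :: "'v \<Rightarrow> real"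
    assume "\<forall>v\<in>V \<union> V'. y v = y' v"
    then have "e x y = e x y'" "e' x y = e' x y'"
      using V(2) V'(2) by blast+
    then show "e x y + e' x y = e x y' + e' x y'"
      by simp
  qed (use V V' in simp)
next
  case (affine_scale e c)
  from affine_scale.IH obtain V where V: "finite V"
    "\<forall>x y y'. (\<forall>v\<in>V. y v = y' v) \<longrightarrow> e x y = e x y'"
    by blast
  show ?case
  proof (intro exI[of _ V] conjI allI impI)
    fix x and y y' :: "'v \<Rightarrow> real"
    assume "\<forall>v\<in>V. y v = y' v"
    then have "e x y = e x y'"
      using V(2) by blast
    then show "c * e x y = c * e x y'"
      by simp
  qed (use V in simp)
qed auto

lemma affine_at_zero:
  assumes "affine_expr e"
  shows "\<exists>a c. \<forall>x. e x (\<lambda>_. 0) = a \<bullet> x + c"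
  using assms
proof induction
  case (affine_inner a)
  then show ?case by (metis add.right_neutral)
next
  case (affine_var v)
  then show ?case by (metis add.right_neutral inner_zero_left)
next
  case (affine_const c)
  then show ?case by (metis add.left_neutral inner_zero_left)
next
  case (affine_add e e')
  then obtain a c a' c' where "\<And>x. e x (\<lambda>_. 0) = a \<bullet> x + c" "\<And>x. e' x (\<lambda>_. 0) = a' \<bullet> x + c'"
    by metis
  then show ?case
    by (intro exI[of _ "a + a'"] exI[of _ "c + c'"]) (simp add: inner_add_left)
next
  case (affine_scale e k)
  then obtain a c where "\<And>x. e x (\<lambda>_. 0) = a \<bullet> x + c"
    by metis
  then show ?case
    by (intro exI[of _ "k *\<^sub>R a"] exI[of _ "k * c"]) (simp add: distrib_left)
qed

definition lin_system :: "('x::euclidean_space \<Rightarrow> ('v \<Rightarrow> real) \<Rightarrow> bool) \<Rightarrow> bool" where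
  "lin_system R \<longleftrightarrow>
     (\<exists>E. finite E \<and> (\<forall>e\<in>E. affine_expr e) \<and> (\<forall>x y. R x y \<longleftrightarrow> (\<forall>e\<in>E. e x y \<le> 0)))"

lemma lin_le:
  assumes "affine_expr e" "affine_expr e'"
  shows "lin_system (\<lambda>x y. e x y \<le> e' x y)"
  unfolding lin_system_def
  by (rule exI[of _ "{\<lambda>x y. e x y - e' x y}"]) (simp add: affine_diff assms)

lemma lin_True: "lin_system (\<lambda>x y. True)"
  unfolding lin_system_def by (rule exI[of _ "{}"]) simp

lemma lin_conj:
  assumes "lin_system R" "lin_system R'"
  shows "lin_system (\<lambda>x y. R x y \<and> R' x y)"
proof -
  obtain E E' where
    "finite E" "\<forall>e\<in>E. affine_expr e" "\<And>x y. R x y \<longleftrightarrow> (\<forall>e\<in>E. e x y \<le> 0)"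
    "finite E'" "\<forall>e\<in>E'. affine_expr e" "\<And>x y. R' x y \<longleftrightarrow> (\<forall>e\<in>E'. e x y \<le> 0)"
    using assms unfolding lin_system_def by metis
  then show ?thesis
    unfolding lin_system_def by (intro exI[of _ "E \<union> E'"]) auto
qed

lemma lin_eq:
  assumes "affine_expr e" "affine_expr e'"
  shows "lin_system (\<lambda>x y. e x y = e' x y)"
  using lin_conj[OF lin_le[OF assms] lin_le[OF assms(2,1)]] by (simp add: eq_iff)

lemma lin_ball:
  assumes "finite I" "\<And>i. i \<in> I \<Longrightarrow> lin_system (R i)"
  shows "lin_system (\<lambda>x y. \<forall>i\<in>I. R i x y)"
  using assms by (induction I) (auto intro: lin_True lin_conj)

lemma lin_all:
  assumes "\<And>i::'i::finite. lin_system (R i)"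
  shows "lin_system (\<lambda>x y. \<forall>i. R i x y)"
  using lin_ball[of UNIV R] assms by simp

lemma lin_imp:
  assumes "P \<Longrightarrow> lin_system R"
  shows "lin_system (\<lambda>x y. P \<longrightarrow> R x y)"
  using assms by (cases P) (simp_all add: lin_True)

lemma lin_all_less:
  fixes n :: nat
  assumes "\<And>i. i < n \<Longrightarrow> lin_system (R i)"
  shows "lin_system (\<lambda>x y. \<forall>i<n. R i x y)"
  using lin_ball[of "{..<n}" R] assms by (simp add: Ball_def)

text \<open>Fourier--Motzkin elimination of one variable: the constraints with \<open>q e < 0\<close> bound \<open>t\<close> from below,
  those with \<open>q e > 0\<close> from above, and a value in between exists iff each lower bound is at most each
  upper bound.\<close>

lemma one_variable_feasible:
  fixes p q :: "'e \<Rightarrow> real"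
  assumes "finite E"
  shows "(\<exists>t. \<forall>e\<in>E. p e + q e * t \<le> 0) \<longleftrightarrow>
    (\<forall>e\<in>E. q e = 0 \<longrightarrow> p e \<le> 0) \<and>
    (\<forall>e\<in>E. \<forall>e'\<in>E. 0 < q e \<and> q e' < 0 \<longrightarrow> q e * p e' - q e' * p e \<le> 0)"
    (is "?L \<longleftrightarrow> ?Z \<and> ?C")
proof
  assume ?L
  then obtain t where t: "\<And>e. e \<in> E \<Longrightarrow> p e + q e * t \<le> 0"
    by blast
  have "q e * p e' - q e' * p e \<le> 0" if "e \<in> E" "e' \<in> E" "0 < q e" "q e' < 0" for e e'
  proof -
    have "q e * (p e' + q e' * t) \<le> 0"
      using t[OF that(2)] that(3) by (simp add: mult_le_0_iff)
    moreover have "- q e' * (p e + q e * t) \<le> 0"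
      using t[OF that(1)] that(4) by (metis mult_le_0_iff neg_0_le_iff_le less_imp_le)
    ultimately show ?thesis
      by (simp add: algebra_simps)
  qed
  with t show "?Z \<and> ?C"
    by force
next
  assume R: "?Z \<and> ?C"
  let ?lo = "(\<lambda>e. - p e / q e) ` {e\<in>E. q e < 0}" and ?up = "(\<lambda>e. - p e / q e) ` {e\<in>E. 0 < q e}"
  have fin: "finite ?lo" "finite ?up"
    using assms by auto
  have sep: "l \<le> u" if "l \<in> ?lo" "u \<in> ?up" for l u
    using that R by (auto simp: field_simps)
  \<comment> \<open>the largest lower bound, or the least upper bound if there are no lower bounds\<close>
  obtain t where t: "\<And>l. l \<in> ?lo \<Longrightarrow> l \<le> t" "\<And>u. u \<in> ?up \<Longrightarrow> t \<le> u"
  proof (cases "?lo = {}")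
    case True
    show ?thesis
    proof (cases "?up = {}")
      case True
      with \<open>?lo = {}\<close> show ?thesis using that by blast
    next
      case False
      show ?thesis
        by (rule that[of "Min ?up"]) (use \<open>?lo = {}\<close> fin in \<open>auto intro: Min_le\<close>)
    qed
  next
    case False
    then have "Max ?lo \<in> ?lo"
      using fin by (intro Max_in)
    then show ?thesis
      using fin(1) sep by (intro that[of "Max ?lo"] Max_ge)
  qed
  have "p e + q e * t \<le> 0" if "e \<in> E" for e
  proof -
    consider "q e = 0" | "q e < 0" | "0 < q e" by linarith
    then show ?thesis
    proof cases
      case 1 then show ?thesis using R that by simp
    next
      case 2
      then have "- p e / q e \<le> t" using that by (intro t(1)) auto
      then show ?thesis using 2 by (simp add: field_simps)
    next
      case 3
      then have "t \<le> - p e / q e" using that by (intro t(2)) auto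
      then show ?thesis using 3 by (simp add: field_simps)
    qed
  qed
  then show ?L by blast
qed

lemma lin_eliminate_variable:
  assumes "lin_system R"
  shows "lin_system (\<lambda>x y. \<exists>t. R x (y(v := t)))"
proof -
  obtain E where E: "finite E" "\<forall>e\<in>E. affine_expr e" "\<And>x y. R x y \<longleftrightarrow> (\<forall>e\<in>E. e x y \<le> 0)"
    using assms unfolding lin_system_def by metis
  have "\<forall>e\<in>E. \<exists>qp. affine_expr (snd qp) \<and> (\<forall>x y t. e x (y(v := t)) = snd qp x y + fst qp * t)"
    using affine_split_variable[of _ v] E(2) by force
  from bchoice[OF this] obtain qp where
    "\<forall>e\<in>E. affine_expr (snd (qp e)) \<and>
       (\<forall>x y t. e x (y(v := t)) = snd (qp e) x y + fst (qp e) * t)" ..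
  then obtain q p where aff: "\<And>e. e \<in> E \<Longrightarrow> affine_expr (p e)" and
    split: "\<And>e x y t. e \<in> E \<Longrightarrow> e x (y(v := t)) = p e x y + q e * t"
    by (intro that[of "\<lambda>e. snd (qp e)" "\<lambda>e. fst (qp e)"]) simp_all
  have "(\<exists>t. R x (y(v := t))) \<longleftrightarrow>
     (\<forall>e\<in>{e\<in>E. q e = 0}. p e x y \<le> 0) \<and>
     (\<forall>e\<in>{e\<in>E. 0 < q e}. \<forall>e'\<in>{e\<in>E. q e < 0}. q e * p e' x y - q e' * p e x y \<le> 0)" for x y
    unfolding mem_Collect_eq Ball_def E(3)
    using one_variable_feasible[OF E(1), of "\<lambda>e. p e x y" q] by (simp add: split Ball_def imp_conjL)
  moreover have "lin_system (\<lambda>x y.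
     (\<forall>e\<in>{e\<in>E. q e = 0}. p e x y \<le> 0) \<and>
     (\<forall>e\<in>{e\<in>E. 0 < q e}. \<forall>e'\<in>{e\<in>E. q e < 0}. q e * p e' x y - q e' * p e x y \<le> 0))"
    using E(1) by (intro lin_conj lin_ball lin_le affine_diff affine_scale affine_const aff) auto
  ultimately show ?thesis by simp
qed

lemma lin_eliminate_variables:
  assumes "finite V" "lin_system R"
  shows "lin_system (\<lambda>x y. \<exists>y'. (\<forall>u. u \<notin> V \<longrightarrow> y' u = y u) \<and> R x y')"
  using assms
proof (induction V)
  case empty
  have "(\<exists>y'. (\<forall>u. u \<notin> {} \<longrightarrow> y' u = y u) \<and> R x y') \<longleftrightarrow> R x y" for x y
    by (auto simp flip: fun_eq_iff)
  with empty show ?case by simp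
next
  case (insert v V)
  have eq: "(\<exists>y'. (\<forall>u. u \<notin> insert v V \<longrightarrow> y' u = y u) \<and> R x y') \<longleftrightarrow>
      (\<exists>t y'. (\<forall>u. u \<notin> V \<longrightarrow> y' u = (y(v := t)) u) \<and> R x y')" for x y
  proof
    assume "\<exists>y'. (\<forall>u. u \<notin> insert v V \<longrightarrow> y' u = y u) \<and> R x y'"
    then obtain y' where "\<forall>u. u \<notin> insert v V \<longrightarrow> y' u = y u" "R x y'"
      by blast
    then show "\<exists>t y'. (\<forall>u. u \<notin> V \<longrightarrow> y' u = (y(v := t)) u) \<and> R x y'"
      by (intro exI[of _ "y' v"] exI[of _ y']) simp
  next
    assume "\<exists>t y'. (\<forall>u. u \<notin> V \<longrightarrow> y' u = (y(v := t)) u) \<and> R x y'"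
    then show "\<exists>y'. (\<forall>u. u \<notin> insert v V \<longrightarrow> y' u = y u) \<and> R x y'"
      by (metis fun_upd_other insertCI)
  qed
  show ?case
    unfolding eq by (intro lin_eliminate_variable insert)
qed

text \<open>As only finitely many variables occur, all others may be set to zero, and the occurring ones are
  eliminated one after the other.\<close>

lemma lin_projection:
  assumes "lin_system R"
  obtains K where "finite K" "\<And>x. (\<exists>y. R x y) \<longleftrightarrow> (\<forall>(a, c)\<in>K. a \<bullet> x + c \<le> 0)"
proof -
  obtain E where E: "finite E" "\<forall>e\<in>E. affine_expr e" "\<And>x y. R x y \<longleftrightarrow> (\<forall>e\<in>E. e x y \<le> 0)"
    using assms unfolding lin_system_def by metis
  have "\<forall>e\<in>E. \<exists>V. finite V \<and> (\<forall>x y y'. (\<forall>v\<in>V. y v = y' v) \<longrightarrow> e x y = e x y')"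
    using affine_finite_support E(2) by blast
  from bchoice[OF this] obtain S where S: "\<And>e. e \<in> E \<Longrightarrow> finite (S e)"
    "\<And>e x y y'. e \<in> E \<Longrightarrow> \<forall>v\<in>S e. y v = y' v \<Longrightarrow> e x y = e x y'"
    by blast
  define V where "V = (\<Union>e\<in>E. S e)"
  have "finite V"
    using E(1) S(1) by (simp add: V_def)
  have R_cong: "R x y \<longleftrightarrow> R x y'" if "\<forall>v\<in>V. y v = y' v" for x y y'
  proof -
    have "e x y = e x y'" if "e \<in> E" for e
      using that \<open>\<forall>v\<in>V. y v = y' v\<close> by (intro S(2)) (auto simp: V_def)
    then show ?thesis
      unfolding E(3) by metis
  qed
  have ex: "(\<exists>y. R x y) \<longleftrightarrow> (\<exists>y'. (\<forall>u. u \<notin> V \<longrightarrow> y' u = 0) \<and> R x y')" for x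
  proof
    assume "\<exists>y. R x y"
    then obtain y where "R x y" ..
    then show "\<exists>y'. (\<forall>u. u \<notin> V \<longrightarrow> y' u = 0) \<and> R x y'"
      using R_cong[of y "\<lambda>v. if v \<in> V then y v else 0"]
      by (intro exI[of _ "\<lambda>v. if v \<in> V then y v else 0"]) simp
  qed blast
  from lin_eliminate_variables[OF \<open>finite V\<close> assms]
  obtain E' where E': "finite E'" "\<forall>e\<in>E'. affine_expr e"
    "\<And>x y. (\<exists>y'. (\<forall>u. u \<notin> V \<longrightarrow> y' u = y u) \<and> R x y') \<longleftrightarrow> (\<forall>e\<in>E'. e x y \<le> 0)"
    unfolding lin_system_def by (elim exE conjE) simp
  have "\<forall>e\<in>E'. \<exists>ac. \<forall>x. e x (\<lambda>_. 0) = fst ac \<bullet> x + snd ac"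
    using affine_at_zero E'(2) by force
  from bchoice[OF this] obtain ac where
    ac: "\<And>e x. e \<in> E' \<Longrightarrow> e x (\<lambda>_. 0) = fst (ac e) \<bullet> x + snd (ac e)"
    by blast
  show ?thesis
  proof (rule that[of "ac ` E'"])
    show "finite (ac ` E')"
      using E'(1) by simp
    show "(\<exists>y. R x y) \<longleftrightarrow> (\<forall>(a, c)\<in>ac ` E'. a \<bullet> x + c \<le> 0)" for x
      using E'(3)[of "\<lambda>_. 0" x] by (simp add: ex ac case_prod_beta)
  qed
qed

section \<open>Value functions of parametric linear programs\<close>

text \<open>\<open>R (x, r) y\<close> says that \<open>y\<close> is feasible for \<open>x\<close> at cost at most \<open>r\<close>.  The projection to \<open>(x, r)\<close> is
  the epigraph of the value function.  Monotonicity in \<open>r\<close> forces its inequalities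
  \<open>a \<bullet> x + s * r + c \<le> 0\<close> to have \<open>s \<le> 0\<close>.  Those with \<open>s < 0\<close> are affine minorants, and those
  with \<open>s = 0\<close> describe the domain, so that at a feasible \<open>x\<close> the largest minorant is itself a
  feasible bound.\<close>

lemma value_function_pieces:
  fixes R :: "'x::euclidean_space \<times> real \<Rightarrow> ('v \<Rightarrow> real) \<Rightarrow> bool"
  assumes R: "lin_system R"
    and mono: "\<And>x r r' y. R (x, r) y \<Longrightarrow> r \<le> r' \<Longrightarrow> R (x, r') y"
    and nonneg: "\<And>x r y. R (x, r) y \<Longrightarrow> 0 \<le> r"
  shows "\<exists>K. finite K \<and>
    (\<forall>g b x r y. (g, b) \<in> K \<longrightarrow> R (x, r) y \<longrightarrow> g \<bullet> x + b \<le> r) \<and>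
    (\<forall>x r y. R (x, r) y \<longrightarrow> (\<exists>g b y'. (g, b) \<in> K \<and> R (x, g \<bullet> x + b) y'))"
proof -
  obtain H where "finite H" and H: "\<And>z. (\<exists>y. R z y) \<longleftrightarrow> (\<forall>(a, c)\<in>H. a \<bullet> z + c \<le> 0)"
    by (rule lin_projection[OF R]) blast
  have H': "(\<exists>y. R (x, r) y) \<longleftrightarrow> (\<forall>((a, s), c)\<in>H. a \<bullet> x + s * r + c \<le> 0)" for x r
    by (simp add: H case_prod_beta inner_prod_def)
  define K where "K = (\<lambda>((a, s), c). ((1 / - s) *\<^sub>R a, c / - s)) ` {((a, s), c) \<in> H. s < 0}"
  have "finite K"
    unfolding K_def by (intro finite_imageI finite_subset[OF _ \<open>finite H\<close>]) auto
  have lower: "g \<bullet> x + b \<le> r" if "(g, b) \<in> K" "R (x, r) y" for g b x r y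
  proof -
    obtain a s c where asc: "((a, s), c) \<in> H" "s < 0" "g = (1 / - s) *\<^sub>R a" "b = c / - s"
      using \<open>(g, b) \<in> K\<close> unfolding K_def by auto
    have "a \<bullet> x + s * r + c \<le> 0"
      using H'[of x r] that(2) asc(1) by auto
    then show ?thesis
      using asc by (simp add: field_simps)
  qed
  have attained: "\<exists>g b y'. (g, b) \<in> K \<and> R (x, g \<bullet> x + b) y'" if xr: "R (x, r) y" for x r y
  proof -
    have s_le: "s \<le> 0" if "((a, s), c) \<in> H" for a s c
    proof (rule ccontr)
      assume "\<not> s \<le> 0"
      then have s: "0 < s" by simp
      \<comment> \<open>with \<open>s > 0\<close>, a large \<open>r'\<close> violates the inequality although it is an admissible bound\<close>
      define r' where "r' = max r ((1 - a \<bullet> x - c) / s)"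
      have "(1 - a \<bullet> x - c) / s \<le> r'" by (simp add: r'_def)
      then have "1 \<le> a \<bullet> x + s * r' + c"
        using s by (simp add: field_simps)
      moreover have "R (x, r') y"
        by (rule mono[OF xr]) (simp add: r'_def)
      then have "a \<bullet> x + s * r' + c \<le> 0"
        using H'[of x r'] that by auto
      ultimately show False by simp
    qed
    have s0: "a \<bullet> x + c \<le> 0" if "((a, 0), c) \<in> H" for a c
      using H'[of x r] xr that by fastforce
    have feasible: "\<exists>y'. R (x, m) y'" if m: "\<forall>(g, b)\<in>K. g \<bullet> x + b \<le> m" for m
    proof -
      have "a \<bullet> x + s * m + c \<le> 0" if asc: "((a, s), c) \<in> H" for a s c
      proof (cases "s = 0")
        case True
        then show ?thesis using s0 asc by simp
      next
        case False
        then have "s < 0" using s_le[OF asc] by simp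
        then have "((1 / - s) *\<^sub>R a, c / - s) \<in> K"
          using asc unfolding K_def by force
        then have "((1 / - s) *\<^sub>R a) \<bullet> x + c / - s \<le> m"
          using m by fastforce
        then show ?thesis
          using \<open>s < 0\<close> by (simp add: field_simps)
      qed
      then show ?thesis
        using H'[of x m] by auto
    qed
    \<comment> \<open>otherwise every bound, even a negative one, would be feasible at \<open>x\<close>\<close>
    have "K \<noteq> {}"
      using feasible[of "- 1"] nonneg by force
    define m where "m = Max ((\<lambda>(g, b). g \<bullet> x + b) ` K)"
    have "m \<in> (\<lambda>(g, b). g \<bullet> x + b) ` K"
      unfolding m_def using \<open>finite K\<close> \<open>K \<noteq> {}\<close> by (intro Max_in) auto
    then obtain g b where gb: "(g, b) \<in> K" "m = g \<bullet> x + b"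
      by auto
    have "\<forall>(g, b)\<in>K. g \<bullet> x + b \<le> m"
      unfolding m_def using \<open>finite K\<close> by (auto intro!: Max_ge image_eqI)
    from feasible[OF this] gb show ?thesis
      by blast
  qed
  show ?thesis
    by (intro exI[of _ K] conjI allI impI \<open>finite K\<close> lower attained)
qed

section \<open>Weekly operations as a linear system\<close>

text \<open>Names for the scalar components of an operations record, which turn such records into real
  valuations as used by \<open>affine_expr\<close>.\<close>

datatype ('n, 'br, 'dc, 'g, 'es, 'ld, 'uc, 'hy) op_var =
    PG nat 'g | RG nat 'g | PES nat 'es | PCHG nat 'es | PDIS nat 'es | RDIS nat 'es | SOC nat 'es
  | ZUC 'uc | COMMIT nat 'uc | STARTUP nat 'uc | SHUTDOWN nat 'uc | QHY nat 'hy
  | PNI nat "'n option" | PBR nat 'br | PDC nat 'dc | PSH nat 'ld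
  | PBRC nat 'br 'br | SLACK nat 'br 'br

definition ops_of ::
  "(('n::finite,'br::finite,'dc::finite,'g::finite,'es::finite,'ld::finite,'uc::finite,'hy::finite)
      op_var \<Rightarrow> real) \<Rightarrow> ('n,'br,'dc,'g,'es,'ld,'uc,'hy) ops" where
  "ops_of v =
     \<lparr>pg = (\<lambda>t. \<chi> i. v (PG t i)), rg = (\<lambda>t. \<chi> i. v (RG t i)), pes = (\<lambda>t. \<chi> i. v (PES t i)),
      pchg = (\<lambda>t. \<chi> i. v (PCHG t i)), pdis = (\<lambda>t. \<chi> i. v (PDIS t i)),
      rdis = (\<lambda>t. \<chi> i. v (RDIS t i)), soc = (\<lambda>t. \<chi> i. v (SOC t i)), zuc = (\<chi> i. v (ZUC i)),
      commit = (\<lambda>t. \<chi> i. v (COMMIT t i)), startup = (\<lambda>t. \<chi> i. v (STARTUP t i)),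
      shutdown = (\<lambda>t. \<chi> i. v (SHUTDOWN t i)), qhy = (\<lambda>t. \<chi> i. v (QHY t i)),
      pni = (\<lambda>t. \<chi> i. v (PNI t i)), pbr = (\<lambda>t. \<chi> i. v (PBR t i)),
      pdc = (\<lambda>t. \<chi> i. v (PDC t i)), psh = (\<lambda>t. \<chi> i. v (PSH t i)),
      pbrc = (\<lambda>t i j. v (PBRC t i j)), slack = (\<lambda>t i j. v (SLACK t i j))\<rparr>"

lemma surj_ops_of: "\<exists>v. ops_of v = y"
proof
  show "ops_of (\<lambda>u. case u of
      PG t i \<Rightarrow> pg y t $ i | RG t i \<Rightarrow> rg y t $ i | PES t i \<Rightarrow> pes y t $ i | PCHG t i \<Rightarrow> pchg y t $ i
    | PDIS t i \<Rightarrow> pdis y t $ i | RDIS t i \<Rightarrow> rdis y t $ i | SOC t i \<Rightarrow> soc y t $ i | ZUC i \<Rightarrow> zuc y $ i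
    | COMMIT t i \<Rightarrow> commit y t $ i | STARTUP t i \<Rightarrow> startup y t $ i
    | SHUTDOWN t i \<Rightarrow> shutdown y t $ i | QHY t i \<Rightarrow> qhy y t $ i | PNI t i \<Rightarrow> pni y t $ i
    | PBR t i \<Rightarrow> pbr y t $ i | PDC t i \<Rightarrow> pdc y t $ i | PSH t i \<Rightarrow> psh y t $ i
    | PBRC t i j \<Rightarrow> pbrc y t i j | SLACK t i j \<Rightarrow> slack y t i j) = y"
    by (cases y) (simp add: ops_of_def)
qed

lemma first_stage_parts:
  "x_g x = fst x" "x_esp x = fst (snd x)" "x_ese x = fst (snd (snd x))"
  "x_br x = fst (snd (snd (snd x)))" "x_inv x = fst (snd (snd (snd (snd x))))"
  "x_em x = snd (snd (snd (snd (snd x))))"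
  by (cases x; simp)+

text \<open>The parameter is a first-stage vector together with a further component, which for the cost
  constraint is the cost bound \<open>r\<close>.\<close>

lemma affine_first_stage:
  shows
  "affine_expr (\<lambda>(z::('g::finite,'es::finite,'br::finite,'hy::finite,'w::finite) fst_stage \<times> 'p::euclidean_space) y.
     x_g (fst z) $ g)"
  "affine_expr (\<lambda>(z::('g,'es,'br,'hy,'w) fst_stage \<times> 'p) y. x_esp (fst z) $ es)"
  "affine_expr (\<lambda>(z::('g,'es,'br,'hy,'w) fst_stage \<times> 'p) y. x_ese (fst z) $ es)"
  "affine_expr (\<lambda>(z::('g,'es,'br,'hy,'w) fst_stage \<times> 'p) y. x_br (fst z) $ br)"
  "affine_expr (\<lambda>(z::('g,'es,'br,'hy,'w) fst_stage \<times> 'p) y. x_inv (fst z) $ w $ hy)"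
  "affine_expr (\<lambda>(z::('g,'es,'br,'hy,'w) fst_stage \<times> 'p) y. x_em (fst z) $ w)"
  "affine_expr (\<lambda>(z::('g,'es,'br,'hy,'w) fst_stage \<times> real) y. snd z)"
  unfolding first_stage_parts by (rule affine_linear, rule linearI, simp, simp)+

lemmas affine_intros =
  affine_var affine_const affine_add affine_scale affine_divide affine_uminus
  affine_diff affine_sum affine_first_stage

lemmas lin_intros = lin_imp lin_conj lin_ball lin_all lin_all_less lin_le lin_eq

lemmas componentwise = less_eq_vec_def vec_eq_iff matrix_vector_mult_def inner_vec_def

lemma times_vec_nth: "((a::real^'i) * b) $ i = a $ i * b $ i"
  by (simp add: times_vec_def)

lemma lin_gen: "lin_system (\<lambda>z v. gen_ok D (fst z) w (ops_of v))"
  unfolding gen_ok_def Let_def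
  by (simp add: componentwise times_vec_nth if_distrib ops_of_def cong: if_cong)
    (intro lin_intros affine_intros; simp)

lemma lin_storage: "lin_system (\<lambda>z v. storage_ok D (fst z) (ops_of v))"
  unfolding storage_ok_def
  by (simp add: componentwise ops_of_def)
    (intro lin_intros affine_intros; simp)

lemma lin_reserve: "lin_system (\<lambda>z v. reserve_ok D w (ops_of v))"
  unfolding reserve_ok_def
  by (simp add: componentwise ops_of_def)
    (intro lin_intros affine_intros; simp)

lemma lin_uc: "lin_system (\<lambda>z v. uc_ok D (fst z) (ops_of v))"
  unfolding uc_ok_def
  by (simp add: componentwise times_vec_nth ops_of_def)
    (intro lin_intros affine_intros; simp)

lemma lin_hydro: "lin_system (\<lambda>z v. hydro_ok D (fst z) w (ops_of v))"
  unfolding hydro_ok_def Let_def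
  by (simp add: componentwise times_vec_nth ops_of_def del: atLeastAtMost_iff)
    (intro lin_intros affine_intros; simp)

lemma lin_network: "lin_system (\<lambda>z v. network_ok D xhat (fst z) w (ops_of v))"
  unfolding network_ok_def
  by (simp add: componentwise ops_of_def)
    (intro lin_intros affine_intros; simp)

lemma lin_contingency:
  assumes "finite J"
  shows "lin_system (\<lambda>z v. contingency_ok D xhat (fst z) J (ops_of v))"
  unfolding contingency_ok_def Let_def case_prod_beta
  by (simp add: ops_of_def)
    (intro lin_intros affine_intros; simp add: assms)

lemma affine_cost: "affine_expr (\<lambda>z v. op_cost D w J (ops_of v))"
  unfolding op_cost_def case_prod_beta
  by (simp add: componentwise ops_of_def)
    (intro affine_intros; simp)

text \<open>The minorants are global, in particular valid outside \<open>\<X>\<close>: this is what makes their gradients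
  subgradients of the extended-valued function \<open>h_r\<close>.\<close>

lemma value_of_week_pieces:
  fixes D :: "('n::finite,'br::finite,'dc::finite,'g::finite,'es::finite,'ld::finite,'uc::finite,
      'hy::finite,'hu::finite,'w::{finite,linorder}) data"
  assumes nonneg: "\<forall>x. \<forall>y\<in>Y_set D xhat x w J. 0 \<le> op_cost D w J y" and "finite J"
  shows "\<exists>K. finite K \<and>
    (\<forall>g b x y. (g, b) \<in> K \<longrightarrow> y \<in> Y_set D xhat x w J \<longrightarrow> g \<bullet> x + b \<le> op_cost D w J y) \<and>
    (\<forall>x. Y_set D xhat x w J \<noteq> {} \<longrightarrow>
       (\<exists>g b. (g, b) \<in> K \<and> (\<exists>y\<in>Y_set D xhat x w J. op_cost D w J y = g \<bullet> x + b)))"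
proof -
  define R where "R z v \<longleftrightarrow> ops_of v \<in> Y_set D xhat (fst z) w J \<and> op_cost D w J (ops_of v) \<le> snd z"
    for z :: "('g,'es,'br,'hy,'w) fst_stage \<times> real" and v
  have "lin_system R"
    unfolding R_def[abs_def] Y_set_def mem_Collect_eq
    by (intro lin_conj lin_gen lin_storage lin_reserve lin_uc lin_hydro lin_network lin_contingency
        lin_le affine_cost affine_first_stage \<open>finite J\<close>)
  moreover have "R (x, r') v" if "R (x, r) v" "r \<le> r'" for x r r' v
    using that by (simp add: R_def)
  moreover have "0 \<le> r" if "R (x, r) v" for x r v
    using that nonneg unfolding R_def by fastforce
  ultimately have "\<exists>K. finite K \<and>
      (\<forall>g b x r v. (g, b) \<in> K \<longrightarrow> R (x, r) v \<longrightarrow> g \<bullet> x + b \<le> r) \<and>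
      (\<forall>x r v. R (x, r) v \<longrightarrow> (\<exists>g b v'. (g, b) \<in> K \<and> R (x, g \<bullet> x + b) v'))"
    by (rule value_function_pieces)
  then obtain K where K: "finite K"
    "\<And>g b x r v. (g, b) \<in> K \<Longrightarrow> R (x, r) v \<Longrightarrow> g \<bullet> x + b \<le> r"
    "\<And>x r v. R (x, r) v \<Longrightarrow> \<exists>g b v'. (g, b) \<in> K \<and> R (x, g \<bullet> x + b) v'"
    by blast
  have lower: "g \<bullet> x + b \<le> op_cost D w J y"
    if gb: "(g, b) \<in> K" and y: "y \<in> Y_set D xhat x w J" for g b x y
  proof -
    obtain v where "ops_of v = y" using surj_ops_of by blast
    with y have "R (x, op_cost D w J y) v" by (simp add: R_def)
    then show ?thesis by (rule K(2)[OF gb])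
  qed
  show ?thesis
  proof (intro exI[of _ K] conjI allI impI K(1) lower)
    fix x assume "Y_set D xhat x w J \<noteq> {}"
    then obtain y where y: "y \<in> Y_set D xhat x w J" by blast
    obtain v where "ops_of v = y" using surj_ops_of by blast
    with y have "R (x, op_cost D w J y) v" by (simp add: R_def)
    then obtain g b v' where gb: "(g, b) \<in> K" and v': "R (x, g \<bullet> x + b) v'"
      using K(3) by blast
    then have "ops_of v' \<in> Y_set D xhat x w J" "op_cost D w J (ops_of v') = g \<bullet> x + b"
      using lower[OF gb, of "ops_of v'" x] by (simp_all add: R_def)
    with gb show "\<exists>g b. (g, b) \<in> K \<and> (\<exists>y\<in>Y_set D xhat x w J. op_cost D w J y = g \<bullet> x + b)"
      by blast
  qed
qed

section \<open>Costs of contingencies\<close>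

lemma finite_J_full: "finite (J_full D)"
proof (rule finite_subset)
  show "J_full D \<subseteq> {1..hours D} \<times> UNIV" by (auto simp: J_full_def)
qed simp

text \<open>The hours of contingencies in \<open>J_full\<close> are hours of the week, so no contingency is lost when summing
  hour by hour.\<close>

lemma sum_over_contingencies:
  assumes "J \<subseteq> J_full D"
  shows "(\<Sum>t=1..hours D. \<Sum>(i, j) | (t, i, j) \<in> J. f t i j) = (\<Sum>(t, i, j)\<in>J. f t i j)"
proof -
  have "J = Sigma {1..hours D} (\<lambda>t. {(i, j). (t, i, j) \<in> J})"
    using assms by (auto simp: J_full_def)
  then have "(\<Sum>(t, i, j)\<in>J. f t i j) =
      (\<Sum>(t, i, j)\<in>Sigma {1..hours D} (\<lambda>t. {(i, j). (t, i, j) \<in> J}). f t i j)"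
    by simp
  also have "\<dots> = (\<Sum>t=1..hours D. \<Sum>(i, j) | (t, i, j) \<in> J. f t i j)"
    by (subst sum.Sigma) simp_all
  finally show ?thesis by simp
qed

lemma inner_vec_nonneg: "0 \<le> a \<Longrightarrow> 0 \<le> b \<Longrightarrow> 0 \<le> a \<bullet> b" for a b :: "real^'i::finite"
  by (simp add: less_eq_vec_def inner_vec_def sum_nonneg)

definition base_cost where
  "base_cost D w y =
     (\<Sum>t=1..hours D. c_g D w t \<bullet> pg y t + c_uc D \<bullet> startup y t + c_sh D * (1 \<bullet> psh y t))"

lemma op_cost_eq:
  assumes "J \<subseteq> J_full D"
  shows "op_cost D w J y = base_cost D w y + c_vio D * (\<Sum>(t, i, j)\<in>J. slack y t i j)"
  unfolding op_cost_def base_cost_def sum_over_contingencies[OF assms, symmetric]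
  by (simp add: sum.distrib sum_distrib_left)

lemma base_cost_nonneg:
  assumes "nonneg_costs D" "y \<in> Y_set D xhat x w J"
  shows "0 \<le> base_cost D w y"
proof -
  have "0 \<le> pg y t" "0 \<le> startup y t" "0 \<le> psh y t" if "t \<in> {1..hours D}" for t
    using assms(2) that by (auto simp: Y_set_def gen_ok_def uc_ok_def network_ok_def Let_def)
  moreover have "0 \<le> (1 :: real^'ld::finite)"
    by (simp add: less_eq_vec_def)
  ultimately show ?thesis
    using assms(1) unfolding base_cost_def nonneg_costs_def
    by (intro sum_nonneg add_nonneg_nonneg mult_nonneg_nonneg inner_vec_nonneg)
      (auto simp: less_eq_vec_def)
qed

lemma slack_nonneg:
  assumes "y \<in> Y_set D xhat x w J" "(t, i, j) \<in> J"
  shows "0 \<le> slack y t i j"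
  using assms by (fastforce simp: Y_set_def contingency_ok_def Let_def)

lemma slack_sum_nonneg:
  assumes "y \<in> Y_set D xhat x w J" "J' \<subseteq> J"
  shows "0 \<le> (\<Sum>(t, i, j)\<in>J'. slack y t i j)"
  using slack_nonneg[OF assms(1)] assms(2) by (intro sum_nonneg) auto

lemma op_cost_nonneg:
  assumes "nonneg_costs D" "J \<subseteq> J_full D" "y \<in> Y_set D xhat x w J"
  shows "0 \<le> op_cost D w J y"
  using base_cost_nonneg[OF assms(1,3)] slack_sum_nonneg[OF assms(3) order_refl] assms(1)
  by (simp add: op_cost_eq[OF assms(2)] nonneg_costs_def)

lemma h_r_nonneg:
  assumes "nonneg_costs D" "J \<subseteq> J_full D"
  shows "0 \<le> h_r D xhat x w J"
  unfolding h_r_def using op_cost_nonneg[OF assms] by (intro INF_greatest) simp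

text \<open>Dropping contingencies removes constraints and nonnegative penalties.\<close>

lemma h_r_mono:
  assumes "nonneg_costs D" "J \<subseteq> J'" "J' \<subseteq> J_full D"
  shows "h_r D xhat x w J \<le> h_r D xhat x w J'"
  unfolding h_r_def
proof (rule INF_mono)
  fix y assume y: "y \<in> Y_set D xhat x w J'"
  have "(\<Sum>(t, i, j)\<in>J. slack y t i j) \<le> (\<Sum>(t, i, j)\<in>J'. slack y t i j)"
    using slack_nonneg[OF y] assms(2,3) finite_subset[OF _ finite_J_full]
    by (intro sum_mono2) auto
  then have "op_cost D w J y \<le> op_cost D w J' y"
    using assms by (simp add: op_cost_eq nonneg_costs_def mult_left_mono)
  moreover have "y \<in> Y_set D xhat x w J"
    using y assms(2) by (auto simp: Y_set_def contingency_ok_def)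
  ultimately show "\<exists>y'\<in>Y_set D xhat x w J. ereal (op_cost D w J y') \<le> ereal (op_cost D w J' y)"
    by auto
qed

lemma h_r_eq_minimum:
  assumes "is_arg_min (op_cost D w J) (\<lambda>y. y \<in> Y_set D xhat x w J) y"
  shows "h_r D xhat x w J = ereal (op_cost D w J y)"
  unfolding h_r_def using assms
  by (intro antisym INF_lower INF_greatest) (auto simp: is_arg_min_linorder)

text \<open>The operations found for \<open>J\<close> stay feasible for all contingencies if every contingency outside \<open>J\<close>
  gets its violation as slack.  The violations outside \<open>J'\<close> vanish, so the penalty for these slacks is
  exactly \<open>\<sigma>\<close>.\<close>

lemma h_r_le_repaired:
  assumes J: "J \<subseteq> J_full D" and or: "oracle_rel D xhat x w J y \<theta> g \<sigma> J'"
  shows "h_r D xhat x w (J_full D) \<le> ereal (\<theta> + \<sigma>)"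
proof -
  have y: "y \<in> Y_set D xhat x w J" and \<theta>: "\<theta> = op_cost D w J y"
    and J': "J' = {\<zeta> \<in> J_full D - J. 0 < violation D xhat x y \<zeta>}"
    and \<sigma>: "\<sigma> = c_vio D * (\<Sum>\<zeta>\<in>J'. violation D xhat x y \<zeta>)"
    using or by (auto simp: oracle_rel_def is_arg_min_def)
  define s where "s t i j = (if (t, i, j) \<in> J then slack y t i j else violation D xhat x y (t, i, j))"
    for t i j
  define y' where "y' = y\<lparr>pbrc := (\<lambda>t i j. pbr y t $ i + Lambda D xhat $ i $ j * pbr y t $ j),
    slack := s\<rparr>"
  have "y' \<in> Y_set D xhat x w (J_full D)"
  proof -
    have "contingency_ok D xhat x (J_full D) y'"
      unfolding contingency_ok_def
    proof (intro ballI, unfold case_prod_beta Let_def, goal_cases)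
      case (1 \<zeta>)
      obtain t i j where \<zeta>: "\<zeta> = (t, i, j)" by (cases \<zeta>)
      show ?case
      proof (cases "\<zeta> \<in> J")
        case True
        then show ?thesis
          using y \<zeta> by (fastforce simp: Y_set_def contingency_ok_def Let_def y'_def s_def)
      next
        case False
        then show ?thesis
          by (simp add: \<zeta> y'_def s_def violation_def) linarith
      qed
    qed
    moreover have "gen_ok D x w y' = gen_ok D x w y" "storage_ok D x y' = storage_ok D x y"
      "reserve_ok D w y' = reserve_ok D w y" "uc_ok D x y' = uc_ok D x y"
      "hydro_ok D x w y' = hydro_ok D x w y" "network_ok D xhat x w y' = network_ok D xhat x w y"
      by (simp_all add: y'_def gen_ok_def storage_ok_def reserve_ok_def uc_ok_def
          hydro_ok_def network_ok_def)
    ultimately show ?thesis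
      using y by (simp add: Y_set_def)
  qed
  then have "h_r D xhat x w (J_full D) \<le> ereal (op_cost D w (J_full D) y')"
    unfolding h_r_def by (rule INF_lower)
  also have "op_cost D w (J_full D) y' = \<theta> + \<sigma>"
  proof -
    have "(\<Sum>(t, i, j)\<in>J_full D. slack y' t i j) =
        (\<Sum>(t, i, j)\<in>J. slack y' t i j) + (\<Sum>(t, i, j)\<in>J_full D - J. slack y' t i j)"
      by (rule sum.subset_diff[OF J finite_J_full, THEN trans]) simp
    moreover have "(\<Sum>(t, i, j)\<in>J. slack y' t i j) = (\<Sum>(t, i, j)\<in>J. slack y t i j)"
      by (intro sum.cong) (auto simp: y'_def s_def)
    moreover have "(\<Sum>(t, i, j)\<in>J_full D - J. slack y' t i j) =
        (\<Sum>\<zeta>\<in>J_full D - J. violation D xhat x y \<zeta>)"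
      by (intro sum.cong) (auto simp: y'_def s_def)
    moreover have "\<dots> = (\<Sum>\<zeta>\<in>J'. violation D xhat x y \<zeta>)"
      using finite_J_full by (intro sum.mono_neutral_right) (auto simp: J' violation_def)
    moreover have "base_cost D w y' = base_cost D w y"
      by (simp add: base_cost_def y'_def)
    ultimately show ?thesis
      by (simp add: op_cost_eq[OF J] op_cost_eq[OF order_refl] \<theta> \<sigma> distrib_left)
  qed
  finally show ?thesis .
qed

section \<open>Maxima of finitely many affine functions\<close>

text \<open>Phrased by minorants, one of which is attained at each point: the form in which
  \<open>value_of_week_pieces\<close> describes \<open>h\<^sup>r\<close>.\<close>

definition max_affine_on :: "'a::real_inner set \<Rightarrow> ('a \<Rightarrow> real) \<Rightarrow> bool" where
  "max_affine_on S f \<longleftrightarrow> (\<exists>K. finite K \<and> (\<forall>g b. (g, b) \<in> K \<longrightarrow> (\<forall>x\<in>S. g \<bullet> x + b \<le> f x)) \<and>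
     (\<forall>x\<in>S. \<exists>g b. (g, b) \<in> K \<and> f x = g \<bullet> x + b))"

lemma max_affine_affine: "max_affine_on S (\<lambda>x. g \<bullet> x + b)"
  unfolding max_affine_on_def by (rule exI[of _ "{(g, b)}"]) simp

lemma max_affine_max:
  assumes "max_affine_on S f" "max_affine_on S f'"
  shows "max_affine_on S (\<lambda>x. max (f x) (f' x))"
proof -
  obtain K K' where
    K: "finite K" "\<And>g b x. (g, b) \<in> K \<Longrightarrow> x \<in> S \<Longrightarrow> g \<bullet> x + b \<le> f x" "\<And>x. x \<in> S \<Longrightarrow> \<exists>g b. (g, b) \<in> K \<and> f x = g \<bullet> x + b" and
    K': "finite K'" "\<And>g b x. (g, b) \<in> K' \<Longrightarrow> x \<in> S \<Longrightarrow> g \<bullet> x + b \<le> f' x" "\<And>x. x \<in> S \<Longrightarrow> \<exists>g b. (g, b) \<in> K' \<and> f' x = g \<bullet> x + b"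
    using assms unfolding max_affine_on_def by (elim exE conjE) simp
  show ?thesis
    unfolding max_affine_on_def
  proof (intro exI[of _ "K \<union> K'"] conjI ballI)
    fix x assume "x \<in> S"
    then show "\<exists>g b. (g, b) \<in> K \<union> K' \<and> max (f x) (f' x) = g \<bullet> x + b"
      unfolding max_def using K(3)[of x] K'(3)[of x] by auto
  qed (use K(1,2) K'(1,2) in \<open>auto simp: le_max_iff_disj\<close>)
qed

lemma max_affine_add:
  assumes "max_affine_on S f" "max_affine_on S f'"
  shows "max_affine_on S (\<lambda>x. f x + f' x)"
proof -
  obtain K K' where
    K: "finite K" "\<And>g b x. (g, b) \<in> K \<Longrightarrow> x \<in> S \<Longrightarrow> g \<bullet> x + b \<le> f x" "\<And>x. x \<in> S \<Longrightarrow> \<exists>g b. (g, b) \<in> K \<and> f x = g \<bullet> x + b" and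
    K': "finite K'" "\<And>g b x. (g, b) \<in> K' \<Longrightarrow> x \<in> S \<Longrightarrow> g \<bullet> x + b \<le> f' x" "\<And>x. x \<in> S \<Longrightarrow> \<exists>g b. (g, b) \<in> K' \<and> f' x = g \<bullet> x + b"
    using assms unfolding max_affine_on_def by (elim exE conjE) simp
  let ?L = "(\<lambda>((g, b), (g', b')). (g + g', b + b')) ` (K \<times> K')"
  show ?thesis
    unfolding max_affine_on_def
  proof (intro exI[of _ ?L] conjI ballI allI impI)
    show "finite ?L" using K(1) K'(1) by simp
  next
    fix a c x assume "(a, c) \<in> ?L" "x \<in> S"
    then obtain g b g' b' where p: "(g, b) \<in> K" "(g', b') \<in> K'" "a = g + g'" "c = b + b'"
      by auto
    then show "a \<bullet> x + c \<le> f x + f' x"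
      using K(2)[of g b x] K'(2)[of g' b' x] \<open>x \<in> S\<close> by (simp add: inner_add_left)
  next
    fix x assume "x \<in> S"
    then obtain g b g' b' where
      p: "(g, b) \<in> K" "(g', b') \<in> K'" "f x = g \<bullet> x + b" "f' x = g' \<bullet> x + b'"
      using K(3)[of x] K'(3)[of x] by auto
    then have "(g + g', b + b') \<in> ?L" by force
    then show "\<exists>a c. (a, c) \<in> ?L \<and> f x + f' x = a \<bullet> x + c"
      by (intro exI[of _ "g + g'"] exI[of _ "b + b'"] conjI) (simp_all add: p inner_add_left)
  qed
qed

lemma max_affine_sum:
  assumes "\<And>i. i \<in> I \<Longrightarrow> max_affine_on S (f i)"
  shows "max_affine_on S (\<lambda>x. \<Sum>i\<in>I. f i x)"
  using assms
proof (induction I rule: infinite_finite_induct)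
  case (insert i I)
  then show ?case by (simp add: max_affine_add)
qed (use max_affine_affine[of S 0 0] in simp_all)

text \<open>If \<open>g\<close> is the gradient of the piece attained at \<open>x\<close>, then \<open>f x - f x'\<close> is at most
  \<open>g \<bullet> (x - x')\<close>; there are finitely many such gradients.\<close>

lemma max_affine_lipschitz:
  assumes "max_affine_on S f"
  obtains M where "M-lipschitz_on S f"
proof -
  obtain K where
    K: "finite K" "\<And>g b x. (g, b) \<in> K \<Longrightarrow> x \<in> S \<Longrightarrow> g \<bullet> x + b \<le> f x" "\<And>x. x \<in> S \<Longrightarrow> \<exists>g b. (g, b) \<in> K \<and> f x = g \<bullet> x + b"
    using assms unfolding max_affine_on_def by (elim exE conjE) simp
  define M where "M = (\<Sum>(g, b)\<in>K. norm g)"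
  have le: "f x - f x' \<le> M * dist x x'" if "x \<in> S" "x' \<in> S" for x x'
  proof -
    obtain g b where gb: "(g, b) \<in> K" "f x = g \<bullet> x + b"
      using K(3) \<open>x \<in> S\<close> by blast
    have "g \<bullet> x' + b \<le> f x'"
      using K(2) gb(1) \<open>x' \<in> S\<close> by blast
    then have "f x - f x' \<le> g \<bullet> (x - x')"
      by (simp add: gb(2) inner_diff_right)
    also have "\<dots> \<le> norm g * dist x x'"
      unfolding dist_norm by (rule norm_cauchy_schwarz)
    also have "norm g \<le> M"
      unfolding M_def using member_le_sum[of "(g, b)" K "\<lambda>(g, b). norm g"] K(1) gb(1)
      by (simp add: case_prod_beta)
    finally show ?thesis by (simp add: mult_right_mono)
  qed
  have "M-lipschitz_on S f"
  proof (rule lipschitz_onI)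
    fix x y assume "x \<in> S" "y \<in> S"
    then show "dist (f x) (f y) \<le> M * dist x y"
      using le[of x y] le[of y x] by (simp add: dist_real_def dist_commute abs_le_iff)
  qed (auto simp: M_def intro: sum_nonneg)
  then show ?thesis by (rule that)
qed

lemma max_affine_continuous: "max_affine_on S f \<Longrightarrow> continuous_on S f"
  by (metis max_affine_lipschitz lipschitz_on_continuous_on)

lemma polyhedron_max_affine_sublevel:
  fixes f :: "'a::euclidean_space \<Rightarrow> real"
  assumes "max_affine_on UNIV f"
  shows "polyhedron {x. f x \<le> r}"
proof -
  obtain K where
    K: "finite K" "\<And>g b x. (g, b) \<in> K \<Longrightarrow> g \<bullet> x + b \<le> f x"
      "\<And>x. \<exists>g b. (g, b) \<in> K \<and> f x = g \<bullet> x + b"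
    using assms unfolding max_affine_on_def by (elim exE conjE) simp
  have "f x \<le> r \<longleftrightarrow> (\<forall>(g, b)\<in>K. g \<bullet> x \<le> r - b)" for x
  proof
    assume "f x \<le> r"
    then show "\<forall>(g, b)\<in>K. g \<bullet> x \<le> r - b"
      using K(2)[of _ _ x] by (fastforce simp: le_diff_eq)
  next
    assume r: "\<forall>(g, b)\<in>K. g \<bullet> x \<le> r - b"
    obtain g b where k: "(g, b) \<in> K" "f x = g \<bullet> x + b"
      using K(3)[of x] by auto
    then have "g \<bullet> x \<le> r - b"
      using r by auto
    then show "f x \<le> r"
      by (simp add: k)
  qed
  then have "{x. f x \<le> r} = (\<Inter>k\<in>K. {x. fst k \<bullet> x \<le> r - snd k})"
    by fastforce
  moreover have "polyhedron \<dots>"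
    using K(1) by (intro polyhedron_Inter) (auto simp: polyhedron_halfspace_le)
  ultimately show ?thesis by simp
qed

section \<open>Analytic centers, level sets and slopes of cuts\<close>

text \<open>The barrier tends to \<open>-\<infinity>\<close> at the relative boundary, so its superlevel sets are compact subsets
  of the relative interior.\<close>

lemma analytic_center_exists:
  fixes Z :: "'a::euclidean_space set"
  assumes "compact Z" "convex Z" "Z \<noteq> {}" "self_concordant_barrier Z \<psi>"
  shows "\<exists>x. is_analytic_center \<psi> Z x"
proof -
  have cont: "continuous_on (rel_interior Z) \<psi>"
    and barrier: "\<And>u l. (\<And>n. u n \<in> rel_interior Z) \<Longrightarrow> l \<in> rel_frontier Z \<Longrightarrow> u \<longlonglongrightarrow> l \<Longrightarrow>
        filterlim (\<lambda>n. \<psi> (u n)) at_bot sequentially"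
    using assms(4) by (auto simp: self_concordant_barrier_def)
  obtain z0 where z0: "z0 \<in> rel_interior Z"
    using assms(2,3) rel_interior_eq_empty by blast
  define S where "S = {z \<in> rel_interior Z. \<psi> z0 \<le> \<psi> z}"
  have "compact S"
    unfolding compact_def
  proof (intro allI impI)
    fix u :: "nat \<Rightarrow> 'a" assume u: "\<forall>n. u n \<in> S"
    then have "\<forall>n. u n \<in> Z"
      using rel_interior_subset by (auto simp: S_def)
    then obtain l r where l: "l \<in> Z" and r: "strict_mono (r::nat\<Rightarrow>nat)" and lim: "(u \<circ> r) \<longlonglongrightarrow> l"
      using \<open>compact Z\<close> unfolding compact_def by blast
    have ur: "(u \<circ> r) n \<in> rel_interior Z" "\<psi> z0 \<le> \<psi> ((u \<circ> r) n)" for n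
      using u by (auto simp: S_def)
    have "l \<notin> rel_frontier Z"
    proof
      assume "l \<in> rel_frontier Z"
      from barrier[OF ur(1) this lim]
      have "\<forall>\<^sub>F n in sequentially. \<psi> ((u \<circ> r) n) < \<psi> z0"
        by (simp add: filterlim_at_bot_dense)
      then show False
        using ur(2) by (auto simp: eventually_sequentially linorder_not_le[symmetric])
    qed
    then have l_int: "l \<in> rel_interior Z"
      using l \<open>compact Z\<close> by (simp add: rel_frontier_def compact_imp_closed)
    have "(\<lambda>n. \<psi> ((u \<circ> r) n)) \<longlonglongrightarrow> \<psi> l"
      using continuous_on_tendsto_compose[OF cont lim l_int] ur(1) by simp
    then have "\<psi> z0 \<le> \<psi> l"
      using ur(2) by (intro LIMSEQ_le_const) auto
    then show "\<exists>l\<in>S. \<exists>r. strict_mono r \<and> (u \<circ> r) \<longlonglongrightarrow> l"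
      using l_int r lim by (auto simp: S_def)
  qed
  moreover have "continuous_on S \<psi>"
    using cont by (rule continuous_on_subset) (auto simp: S_def)
  ultimately obtain x where x: "x \<in> S" "\<And>z. z \<in> S \<Longrightarrow> \<psi> z \<le> \<psi> x"
    using continuous_attains_sup[of S \<psi>] z0 by (auto simp: S_def)
  have "\<not> \<psi> x < \<psi> z" if "z \<in> rel_interior Z" for z
    using x that by (fastforce simp: S_def)
  then have "is_analytic_center \<psi> Z x"
    using x(1) by (auto simp: is_analytic_center_def is_arg_max_def S_def)
  then show ?thesis ..
qed

text \<open>Near the point \<open>m\<close>, where \<open>f\<close> is strictly below the level, there are relative interior points of
  \<open>X\<close>, and they belong to the sublevel set.  A convex subset of \<open>X\<close> that is not contained in the relative
  boundary has its relative interior inside that of \<open>X\<close>.\<close>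

lemma sublevel_rel_interior_subset:
  fixes X :: "'a::euclidean_space set" and f :: "'a \<Rightarrow> real"
  assumes "convex X" "continuous_on UNIV f" "convex {x \<in> X. f x \<le> l}" "m \<in> X" "f m < l"
  shows "rel_interior {x \<in> X. f x \<le> l} \<subseteq> rel_interior X"
proof (rule subset_rel_interior_convex)
  show "{x \<in> X. f x \<le> l} \<subseteq> closure X"
    using closure_subset by blast
  have "open {x. f x < l}"
    by (rule open_Collect_less[OF assms(2) continuous_on_const])
  moreover have "m \<in> closure (rel_interior X)"
    using assms(1,4) closure_subset by (auto simp: convex_closure_rel_interior)
  ultimately obtain p where "p \<in> rel_interior X" "f p < l"
    using assms(5) by (auto simp: closure_iff_nhds_not_empty)
  then show "\<not> {x \<in> X. f x \<le> l} \<subseteq> rel_frontier X"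
    using rel_interior_subset by (fastforce simp: rel_frontier_def)
qed (use assms in auto)

lemma subgradient_inequality:
  "g \<in> subdifferential h x \<Longrightarrow> h x + ereal (g \<bullet> (x' - x)) \<le> h x'"
  by (simp add: subdifferential_def)

text \<open>From a relative interior point \<open>x0\<close> one can move a little in the direction opposite to \<open>x\<close>
  without leaving \<open>X\<close>.  There the subgradient inequality bounds \<open>- g \<bullet> (x - x0)\<close> by the
  increase of \<open>v\<close>.  At relative boundary points no such bound holds for arbitrary subgradients.\<close>

lemma cut_slope_bound:
  fixes X :: "'a::euclidean_space set"
  assumes X: "convex X" "x0 \<in> rel_interior X" "x \<in> X"
    and h: "\<And>z. z \<in> X \<Longrightarrow> h z = ereal (v z)" and lip: "M-lipschitz_on X v"
    and g: "g \<in> subdifferential h x0"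
  shows "- (M * dist x x0) \<le> g \<bullet> (x - x0)"
proof -
  have "x0 \<in> X"
    using X(2) rel_interior_subset by blast
  obtain e where e: "e > 1" "(1 - e) *\<^sub>R x + e *\<^sub>R x0 \<in> X"
    using convex_rel_interior_if2[OF X(1,2)] X(3) hull_inc by metis
  \<comment> \<open>the point beyond \<open>x0\<close> on the ray from \<open>x\<close>\<close>
  define z where "z = (1 - e) *\<^sub>R x + e *\<^sub>R x0"
  have z: "z - x0 = (1 - e) *\<^sub>R (x - x0)"
    by (simp add: z_def algebra_simps)
  have "v x0 + g \<bullet> (z - x0) \<le> v z"
  proof -
    show ?thesis
      using subgradient_inequality[OF g, of z] h[OF \<open>x0 \<in> X\<close>] h[of z] e(2) by (simp add: z_def)
  qed
  moreover have "v z - v x0 \<le> M * dist z x0"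
    using lipschitz_onD[OF lip, of z x0] e(2) \<open>x0 \<in> X\<close> by (simp add: z_def dist_real_def abs_le_iff)
  moreover have "dist z x0 = (e - 1) * dist x x0"
    using e(1) by (simp add: dist_norm z)
  ultimately have "(e - 1) * (- (M * dist x x0)) \<le> (e - 1) * (g \<bullet> (x - x0))"
    by (simp add: z algebra_simps)
  then show ?thesis
    using e(1) by (simp only: mult_le_cancel_left_pos diff_gt_0_iff_gt)
qed

lemma no_separated_sequence_in_compact:
  fixes u :: "nat \<Rightarrow> 'a::metric_space"
  assumes "compact X" "\<And>n. u n \<in> X" "0 < \<delta>"
  shows "\<exists>i k. i < k \<and> dist (u i) (u k) < \<delta>"
proof -
  obtain l r where r: "strict_mono (r::nat\<Rightarrow>nat)" and lim: "(u \<circ> r) \<longlonglongrightarrow> l"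
    using assms(1,2) unfolding compact_def by blast
  from LIMSEQ_imp_Cauchy[OF lim] obtain N where
    "\<And>m n. N \<le> m \<Longrightarrow> N \<le> n \<Longrightarrow> dist ((u \<circ> r) m) ((u \<circ> r) n) < \<delta>"
    using assms(3) unfolding Cauchy_def by blast
  from this[of N "Suc N"] show ?thesis
    using strict_monoD[OF r, of N "Suc N"] by auto
qed

lemma eventually_constant_in_finite:
  fixes A :: "nat \<Rightarrow> 'a set"
  assumes "finite B" "\<And>k. A k \<subseteq> B" "\<And>k. A k \<subseteq> A (Suc k)"
  shows "\<exists>k0. \<forall>k\<ge>k0. A k = A k0"
proof -
  have "mono A"
    using assms(3) by (simp add: mono_iff_le_Suc)
  have "\<exists>k0. \<forall>k. card (A k) \<le> card (A k0)"
    using ex_has_greatest_nat[of "\<lambda>_. True" 0 "\<lambda>k. card (A k)" "card B + 1"]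
      card_mono[OF assms(1,2)] by (auto simp: less_Suc_eq_le)
  then obtain k0 where max: "\<And>k. card (A k) \<le> card (A k0)"
    by blast
  have "A k = A k0" if "k \<ge> k0" for k
  proof -
    have "A k0 \<subseteq> A k"
      using \<open>mono A\<close> that by (rule monoD)
    moreover have "finite (A k)"
      using assms(1,2) finite_subset by blast
    ultimately show ?thesis
      using max[of k] by (metis card_seteq)
  qed
  then show ?thesis by blast
qed

section \<open>Bounds maintained by the bundle method\<close>

lemma polytope_X_set: "polytope (X_set D)"
proof -
  have "1 \<bullet> x_em x = (0, 0, 0, 0, 0, 1) \<bullet> x" for x :: "('g::finite,'es::finite,'br::finite,'hy::finite,'w::finite) fst_stage"
    by (cases x) simp
  then have "X_set D = cbox 0 (xbar D) \<inter> {x. (0, 0, 0, 0, 0, 1) \<bullet> x \<le> em_goal D}"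
    by (auto simp: X_set_def)
  then show ?thesis
    by (simp add: polytope_Int_polyhedron polytope_interval polyhedron_halfspace_le)
qed

lemma iterationE:
  assumes "iteration D xhat s h J L U inc"
  obtains y \<theta> g \<sigma> J' where
    "\<And>w. oracle_rel D xhat (cur s) w (conts s w) (y w) (\<theta> w) (g w) (\<sigma> w) (J' w)"
    "h = (\<lambda>w x. max (model s w x) (\<theta> w + g w \<bullet> (x - cur s)))"
    "J = (\<lambda>w. conts s w \<union> J' w)"
    "U = min (upper s) (ereal (cost_inv D \<bullet> cur s + (\<Sum>w\<in>UNIV. \<theta> w + \<sigma> w)))"
    "inc = (if U = ereal (cost_inv D \<bullet> cur s + (\<Sum>w\<in>UNIV. \<theta> w + \<sigma> w))
       then Some (cur s, y) else incumbent s)"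
  using assms unfolding iteration_def Let_def
  by (elim exE conjE) (rule that, erule spec, assumption+)

locale bundle_problem =
  fixes D :: "('n::finite,'br::finite,'dc::finite,'g::finite,'es::finite,'ld::finite,'uc::finite,
      'hy::finite,'hu::finite,'w::{finite,linorder}) data"
    and xhat :: "real^'br"
  assumes nonneg: "nonneg_costs D"
    and recourse: "complete_recourse D xhat"
    and F_obj_pos: "\<And>x. x \<in> X_set D \<Longrightarrow> 0 < F_obj D xhat x"
begin

abbreviation X where "X \<equiv> X_set D"

lemma compact_X: "compact X" and convex_X: "convex X"
  using polytope_X_set polytope_imp_compact polytope_imp_convex by blast+

text \<open>On \<open>X\<close> the value functions are finite by complete recourse; \<open>week_cost\<close> and \<open>F\<close> are their real
  counterparts.\<close>

definition week_cost where
  "week_cost w J x = real_of_ereal (h_r D xhat x w J)"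

definition F where
  "F x = cost_inv D \<bullet> x + (\<Sum>w\<in>UNIV. week_cost w (J_full D) x)"

lemma week_pieces:
  assumes "J \<subseteq> J_full D"
  shows "\<exists>K. finite K \<and>
    (\<forall>g b x. (g, b) \<in> K \<longrightarrow> ereal (g \<bullet> x + b) \<le> h_r D xhat x w J) \<and>
    (\<forall>x\<in>X. \<exists>g b y. (g, b) \<in> K \<and>
       is_arg_min (op_cost D w J) (\<lambda>y. y \<in> Y_set D xhat x w J) y \<and>
       h_r D xhat x w J = ereal (g \<bullet> x + b))"
proof -
  have "\<forall>x. \<forall>y\<in>Y_set D xhat x w J. 0 \<le> op_cost D w J y"
    using op_cost_nonneg[OF nonneg assms] by blast
  from value_of_week_pieces[of D xhat w J, OF this finite_subset[OF assms finite_J_full]]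
  obtain K where "finite K" and
    below: "\<forall>g b x y. (g, b) \<in> K \<longrightarrow> y \<in> Y_set D xhat x w J \<longrightarrow> g \<bullet> x + b \<le> op_cost D w J y" and
    met: "\<forall>x. Y_set D xhat x w J \<noteq> {} \<longrightarrow>
       (\<exists>g b. (g, b) \<in> K \<and> (\<exists>y\<in>Y_set D xhat x w J. op_cost D w J y = g \<bullet> x + b))"
    by (elim exE conjE) (rule that)
  have lower: "ereal (g \<bullet> x + b) \<le> h_r D xhat x w J" if "(g, b) \<in> K" for g b x
    unfolding h_r_def using below[rule_format, OF that] by (intro INF_greatest) simp
  have attained: "\<exists>g b y. (g, b) \<in> K \<and>
           is_arg_min (op_cost D w J) (\<lambda>y. y \<in> Y_set D xhat x w J) y \<and>
           h_r D xhat x w J = ereal (g \<bullet> x + b)" if "x \<in> X" for x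
  proof -
    have "Y_set D xhat x w J \<noteq> {}"
      using recourse assms that by (simp add: complete_recourse_def)
    then obtain g b y where gb: "(g, b) \<in> K" and y: "y \<in> Y_set D xhat x w J"
      "op_cost D w J y = g \<bullet> x + b"
      using met by blast
    have arg_min: "is_arg_min (op_cost D w J) (\<lambda>y. y \<in> Y_set D xhat x w J) y"
      using below[rule_format, OF gb, of _ x] y by (simp add: is_arg_min_linorder)
    have "h_r D xhat x w J = ereal (g \<bullet> x + b)"
      using h_r_eq_minimum[OF arg_min] y(2) by simp
    with gb arg_min show ?thesis by blast
  qed
  show ?thesis
    by (intro exI[of _ K] conjI allI impI ballI \<open>finite K\<close> lower attained)
qed

lemma h_r_eq_week_cost:
  assumes "x \<in> X" "J \<subseteq> J_full D"
  shows "h_r D xhat x w J = ereal (week_cost w J x)"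
proof -
  obtain c where "h_r D xhat x w J = ereal c"
    using week_pieces[OF assms(2), of w] assms(1) by blast
  then show ?thesis by (simp add: week_cost_def)
qed

lemma F_obj_eq: "x \<in> X \<Longrightarrow> F_obj D xhat x = ereal (F x)"
  by (simp add: F_obj_def F_def h_r_eq_week_cost sum_ereal)

lemma F_pos: "x \<in> X \<Longrightarrow> 0 < F x"
  using F_obj_pos[of x] by (simp add: F_obj_eq)

lemma max_affine_week_cost:
  assumes "J \<subseteq> J_full D"
  shows "max_affine_on X (week_cost w J)"
proof -
  obtain K where "finite K" and
    below: "\<forall>g b x. (g, b) \<in> K \<longrightarrow> ereal (g \<bullet> x + b) \<le> h_r D xhat x w J" and
    met: "\<forall>x\<in>X. \<exists>g b y. (g, b) \<in> K \<and>
       is_arg_min (op_cost D w J) (\<lambda>y. y \<in> Y_set D xhat x w J) y \<and>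
       h_r D xhat x w J = ereal (g \<bullet> x + b)"
    using week_pieces[OF assms, of w] by (elim exE conjE) (rule that)
  show ?thesis
    unfolding max_affine_on_def
  proof (intro exI[of _ K] conjI allI impI ballI)
    show "g \<bullet> x + b \<le> week_cost w J x" if "(g, b) \<in> K" "x \<in> X" for g b x
      using below[rule_format, OF that(1), of x] h_r_eq_week_cost[OF that(2) assms] by simp
    show "\<exists>g b. (g, b) \<in> K \<and> week_cost w J x = g \<bullet> x + b" if "x \<in> X" for x
    proof -
      obtain g b where gb: "(g, b) \<in> K" "h_r D xhat x w J = ereal (g \<bullet> x + b)"
        using met \<open>x \<in> X\<close> by blast
      then have "week_cost w J x = g \<bullet> x + b"
        by (simp add: week_cost_def)
      with gb(1) show ?thesis by blast
    qed
  qed (fact \<open>finite K\<close>)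
qed

lemma F_bounded_below:
  assumes "X \<noteq> {}"
  obtains \<delta> where "0 < \<delta>" "\<And>x. x \<in> X \<Longrightarrow> \<delta> \<le> F x"
proof -
  have "max_affine_on X F"
    using max_affine_add[OF max_affine_affine[of X "cost_inv D" 0]
        max_affine_sum[OF max_affine_week_cost[OF order_refl]]]
    unfolding F_def[abs_def] by simp
  then obtain m where "m \<in> X" "\<And>x. x \<in> X \<Longrightarrow> F m \<le> F x"
    using continuous_attains_inf[OF compact_X assms] max_affine_continuous by meson
  then show ?thesis
    using that F_pos by blast
qed

text \<open>The gradient of the global affine minorant that is attained at \<open>x\<close> is a subgradient.\<close>

lemma oracle_exists:
  assumes "x \<in> X" "J \<subseteq> J_full D"
  shows "\<exists>y \<theta> g \<sigma> J'. oracle_rel D xhat x w J y \<theta> g \<sigma> J'"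
proof -
  obtain K where
    below: "\<forall>g b x. (g, b) \<in> K \<longrightarrow> ereal (g \<bullet> x + b) \<le> h_r D xhat x w J" and
    met: "\<forall>x\<in>X. \<exists>g b y. (g, b) \<in> K \<and>
       is_arg_min (op_cost D w J) (\<lambda>y. y \<in> Y_set D xhat x w J) y \<and>
       h_r D xhat x w J = ereal (g \<bullet> x + b)"
    using week_pieces[OF assms(2), of w] by (elim exE conjE) (rule that)
  obtain g b y where gb: "(g, b) \<in> K" "h_r D xhat x w J = ereal (g \<bullet> x + b)"
    and y: "is_arg_min (op_cost D w J) (\<lambda>y. y \<in> Y_set D xhat x w J) y"
    using bspec[OF met assms(1)] by blast
  have "h_r D xhat x w J + ereal (g \<bullet> (x' - x)) \<le> h_r D xhat x' w J" for x'
    using below[rule_format, OF gb(1), of x'] by (simp add: gb(2) inner_diff_right algebra_simps)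
  then have "g \<in> subdifferential (\<lambda>x. h_r D xhat x w J) x"
    using gb(2) by (simp add: subdifferential_def)
  with y show ?thesis
    unfolding oracle_rel_def by blast
qed

lemma oracle_valueD:
  assumes "oracle_rel D xhat x w J y \<theta> g \<sigma> J'" "x \<in> X" "J \<subseteq> J_full D"
  shows "\<theta> = week_cost w J x" "g \<in> subdifferential (\<lambda>x. h_r D xhat x w J) x"
  using assms h_r_eq_minimum[of D w J xhat x y] h_r_eq_week_cost[OF assms(2,3), of w]
  by (auto simp: oracle_rel_def)

lemma cut_below_week_cost:
  assumes "oracle_rel D xhat x w J y \<theta> g \<sigma> J'" "x \<in> X" "J \<subseteq> J_full D" "x' \<in> X"
  shows "\<theta> + g \<bullet> (x' - x) \<le> week_cost w (J_full D) x'"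
proof -
  have "h_r D xhat x w J + ereal (g \<bullet> (x' - x)) \<le> h_r D xhat x' w J"
    by (rule subgradient_inequality[OF oracle_valueD(2)[OF assms(1-3)]])
  also have "\<dots> \<le> h_r D xhat x' w (J_full D)"
    by (rule h_r_mono[OF nonneg assms(3) order_refl])
  finally show ?thesis
    using oracle_valueD(1)[OF assms(1-3)] h_r_eq_week_cost[OF assms(2,3), of w]
      h_r_eq_week_cost[OF assms(4) order_refl, of w] by simp
qed

text \<open>Invariant of the data kept between iterations: the models are piecewise affine minorants of the full
  value functions, and the upper bound dominates \<open>F\<close> at the incumbent.\<close>

definition sound where
  "sound h J U inc \<longleftrightarrow>
     (\<forall>w. max_affine_on UNIV (h w)) \<and>
     (\<forall>w. \<forall>x\<in>X. h w x \<le> week_cost w (J_full D) x) \<and>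
     (\<forall>w. J w \<subseteq> J_full D) \<and>
     (case inc of None \<Rightarrow> U = \<infinity>
      | Some (x, y) \<Rightarrow> x \<in> X \<and> (\<exists>u. U = ereal u \<and> F x \<le> u) \<and>
          (\<forall>w. \<exists>J\<subseteq>J_full D. y w \<in> Y_set D xhat x w J))"

abbreviation good_state where
  "good_state s \<equiv> cur s \<in> X \<and> sound (model s) (conts s) (upper s) (incumbent s)"

lemma sound_incumbent:
  assumes "sound h J U (Some (x, y))"
  obtains u where "U = ereal u" "x \<in> X" "F x \<le> u" "\<And>w. \<exists>J\<subseteq>J_full D. y w \<in> Y_set D xhat x w J"
  using assms by (auto simp: sound_def)

lemma iteration_sound:
  assumes s: "good_state s" and it: "iteration D xhat s h J L U inc"
  shows "sound h J U inc \<and> inc \<noteq> None"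
proof -
  obtain y \<theta> g \<sigma> J' where
    or: "\<And>w. oracle_rel D xhat (cur s) w (conts s w) (y w) (\<theta> w) (g w) (\<sigma> w) (J' w)"
    and h: "h = (\<lambda>w x. max (model s w x) (\<theta> w + g w \<bullet> (x - cur s)))"
    and J: "J = (\<lambda>w. conts s w \<union> J' w)"
    and U: "U = min (upper s) (ereal (cost_inv D \<bullet> cur s + (\<Sum>w\<in>UNIV. \<theta> w + \<sigma> w)))"
    and inc: "inc = (if U = ereal (cost_inv D \<bullet> cur s + (\<Sum>w\<in>UNIV. \<theta> w + \<sigma> w))
                 then Some (cur s, y) else incumbent s)"
    by (rule iterationE[OF it]) (rule that)
  have x: "cur s \<in> X" and sub: "\<And>w. conts s w \<subseteq> J_full D"
    using s by (auto simp: sound_def)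
  have aff: "max_affine_on UNIV (h w)" for w
  proof -
    have "(\<lambda>x. \<theta> w + g w \<bullet> (x - cur s)) = (\<lambda>x. g w \<bullet> x + (\<theta> w - g w \<bullet> cur s))"
      by (auto simp: inner_diff_right)
    then show ?thesis
      using s max_affine_affine[of UNIV "g w" "\<theta> w - g w \<bullet> cur s"]
      unfolding h sound_def by (intro max_affine_max) auto
  qed
  have below: "h w x' \<le> week_cost w (J_full D) x'" if "x' \<in> X" for w x'
    using s that cut_below_week_cost[OF or x sub that] by (auto simp: h sound_def)
  have "J' w \<subseteq> J_full D" for w
    using or[of w] by (auto simp: oracle_rel_def)
  then have Jsub: "J w \<subseteq> J_full D" for w
    using sub by (auto simp: J)
  have F_le: "F (cur s) \<le> cost_inv D \<bullet> cur s + (\<Sum>w\<in>UNIV. \<theta> w + \<sigma> w)"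
  proof -
    have "week_cost w (J_full D) (cur s) \<le> \<theta> w + \<sigma> w" for w
      using h_r_le_repaired[OF sub or] h_r_eq_week_cost[OF x order_refl] by simp
    then show ?thesis
      unfolding F_def by (intro add_left_mono sum_mono)
  qed
  have ys: "y w \<in> Y_set D xhat (cur s) w (conts s w)" for w
    using or[of w] by (simp add: oracle_rel_def is_arg_min_def)
  show ?thesis
  proof (cases "U = ereal (cost_inv D \<bullet> cur s + (\<Sum>w\<in>UNIV. \<theta> w + \<sigma> w))")
    case True
    have "\<exists>J\<subseteq>J_full D. y w \<in> Y_set D xhat (cur s) w J" for w
      using ys sub by blast
    then show ?thesis
      using True aff below Jsub F_le x by (simp add: sound_def inc)
  next
    case False
    then have "U = upper s" "inc = incumbent s" "upper s \<noteq> \<infinity>"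
      by (auto simp: inc U min_def split: if_splits)
    then show ?thesis
      using s aff below Jsub by (auto simp: sound_def split: option.splits)
  qed
qed

lemma iteration_exists:
  assumes "good_state s"
  shows "\<exists>h J L U inc. iteration D xhat s h J L U inc"
proof -
  have "\<forall>w. \<exists>y \<theta> g \<sigma> J'. oracle_rel D xhat (cur s) w (conts s w) y \<theta> g \<sigma> J'"
    using oracle_exists assms by (simp add: sound_def)
  then obtain y \<theta> g \<sigma> J' where
    "\<forall>w. oracle_rel D xhat (cur s) w (conts s w) (y w) (\<theta> w) (g w) (\<sigma> w) (J' w)"
    unfolding choice_iff by blast
  then show ?thesis
    unfolding iteration_def Let_def by blast
qed

lemma max_affine_f_model:
  assumes "sound h J U inc"
  shows "max_affine_on UNIV (f_model D h)"
  using max_affine_add[OF max_affine_affine[of UNIV "cost_inv D" 0] max_affine_sum[of UNIV UNIV h]] assms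
  unfolding f_model_def[abs_def] sound_def by simp

lemma model_minimum:
  assumes "sound h J U inc" "X \<noteq> {}" "iteration D xhat s h J L U inc"
  obtains m where "m \<in> X" "f_model D h m = L" "\<And>x. x \<in> X \<Longrightarrow> L \<le> f_model D h x"
proof -
  have "continuous_on X (f_model D h)"
    using max_affine_continuous[OF max_affine_f_model[OF assms(1)]] continuous_on_subset by blast
  then obtain m where m: "m \<in> X" "\<And>x. x \<in> X \<Longrightarrow> f_model D h m \<le> f_model D h x"
    using continuous_attains_inf[OF compact_X assms(2)] by meson
  moreover have "L = (INF x\<in>X. f_model D h x)"
    using assms(3) by (auto simp: iteration_def)
  then have "f_model D h m = L"
    using m by (auto intro!: cInf_eq_minimum[symmetric])
  ultimately show ?thesis
    using that by metis
qed

lemma f_model_le_F: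
  assumes "sound h J U inc" "x \<in> X"
  shows "f_model D h x \<le> F x"
  using assms unfolding f_model_def F_def sound_def by (intro add_left_mono sum_mono) auto

lemma relative_gap_less_iff:
  assumes "0 < u"
  shows "(ereal u - ereal L) / ereal u < ereal \<epsilon> \<longleftrightarrow> u - L < \<epsilon> * u"
  using assms by (simp add: field_simps)

text \<open>The test says \<open>(1 - \<epsilon>) U < L\<close>.  For \<open>\<epsilon> \<le> 1\<close> it carries over to \<open>F x \<le> U\<close> and
  \<open>inf F \<ge> L\<close>.  For \<open>\<epsilon> > 1\<close> the bound \<open>L\<close> may be negative and smaller than \<open>(1 - \<epsilon>) F x\<close>, but
  \<open>(1 - \<epsilon>) F x \<le> inf F\<close> holds because \<open>F\<close> is positive.\<close>

lemma stop_eps_optimal: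
  assumes "good_state s" "iteration D xhat s h J L U (Some (x, y))" "(U - ereal L) / U < ereal \<epsilon>"
  shows "eps_optimal D xhat \<epsilon> x \<and> (\<forall>w. \<exists>J\<subseteq>J_full D. y w \<in> Y_set D xhat x w J)"
proof -
  have sound: "sound h J U (Some (x, y))"
    using iteration_sound[OF assms(1,2)] by simp
  then obtain u where u: "U = ereal u" "F x \<le> u" and x: "x \<in> X"
    and y: "\<And>w. \<exists>J\<subseteq>J_full D. y w \<in> Y_set D xhat x w J"
    by (rule sound_incumbent) blast
  have "0 < F x" "0 < u"
    using F_pos[OF x] u(2) by simp_all
  have gap: "u - L < \<epsilon> * u"
    using assms(3) relative_gap_less_iff[OF \<open>0 < u\<close>] by (simp add: u(1))
  have "X \<noteq> {}"
    using x by blast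
  obtain m where m: "\<And>z. z \<in> X \<Longrightarrow> L \<le> f_model D h z"
    by (rule model_minimum[OF sound \<open>X \<noteq> {}\<close> assms(2)]) blast
  have "(1 - \<epsilon>) * F x \<le> F z" if "z \<in> X" for z
  proof (cases "\<epsilon> \<le> 1")
    case True
    have "(1 - \<epsilon>) * F x \<le> (1 - \<epsilon>) * u"
      using u(2) True by (intro mult_left_mono) auto
    also have "\<dots> \<le> L"
      using gap by (simp add: algebra_simps)
    also have "L \<le> F z"
      using m[OF that] f_model_le_F[OF sound that] by simp
    finally show ?thesis .
  next
    case False
    then have "(1 - \<epsilon>) * F x \<le> 0"
      using \<open>0 < F x\<close> by (simp add: mult_le_0_iff)
    then show ?thesis
      using F_pos[OF that] by simp
  qed
  then have le: "ereal ((1 - \<epsilon>) * F x) \<le> (INF z\<in>X. F_obj D xhat z)"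
    by (intro INF_greatest) (simp add: F_obj_eq)
  moreover have "(INF z\<in>X. F_obj D xhat z) \<le> ereal (F x)"
    using x by (intro INF_lower2[OF x]) (simp add: F_obj_eq)
  ultimately obtain i where i: "(INF z\<in>X. F_obj D xhat z) = ereal i"
    by (cases "INF z\<in>X. F_obj D xhat z") auto
  have "eps_optimal D xhat \<epsilon> x"
    using le x unfolding eps_optimal_def i F_obj_eq[OF x] by (simp add: algebra_simps)
  with y show ?thesis by blast
qed

text \<open>When the test fails, \<open>U - L \<ge> \<epsilon> U > 0\<close>, so the level lies strictly above the minimum \<open>L\<close> of the
  model.  The level set is therefore a nonempty polytope, on which a center exists, and it meets the
  relative interior of \<open>X\<close>.\<close>

lemma level_set_center:
  assumes s: "good_state s" "iteration D xhat s h J L U inc" "\<not> (U - ereal L) / U < ereal \<epsilon>"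
    and "0 < \<epsilon>" "0 < \<alpha>"
    and barrier: "\<And>Z. polytope Z \<Longrightarrow> Z \<noteq> {} \<Longrightarrow> self_concordant_barrier Z (\<Psi> Z)"
    and Z: "Z = {x \<in> X. ereal (f_model D h x) \<le> ereal L + ereal \<alpha> * (U - ereal L)}"
  obtains u where "U = ereal u" "\<epsilon> * u \<le> u - L" "\<exists>x\<in>X. F x \<le> u"
    "Z = {x \<in> X. f_model D h x \<le> L + \<alpha> * (u - L)}"
    "\<exists>x. is_analytic_center (\<Psi> Z) Z x" "rel_interior Z \<subseteq> rel_interior X"
proof -
  have sound: "sound h J U inc" and "inc \<noteq> None"
    using iteration_sound[OF s(1,2)] by simp_all
  then obtain u x y where u: "U = ereal u" "F x \<le> u" and x: "x \<in> X"
    using sound_incumbent by (metis not_None_eq surj_pair)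
  have "0 < u"
    using F_pos[OF x] u(2) by simp
  have gap: "\<epsilon> * u \<le> u - L"
    using s(3) unfolding u(1) relative_gap_less_iff[OF \<open>0 < u\<close>] by simp
  have level: "L < L + \<alpha> * (u - L)"
    using gap \<open>0 < u\<close> \<open>0 < \<epsilon>\<close> \<open>0 < \<alpha>\<close> by (smt (verit) mult_pos_pos)
  have "X \<noteq> {}"
    using x by blast
  obtain m where m: "m \<in> X" "f_model D h m = L"
    by (rule model_minimum[OF sound \<open>X \<noteq> {}\<close> s(2)])
  have Z': "Z = {x \<in> X. f_model D h x \<le> L + \<alpha> * (u - L)}"
    by (simp add: Z u(1))
  have "Z = X \<inter> {x. f_model D h x \<le> L + \<alpha> * (u - L)}"
    by (auto simp: Z')
  moreover have "polytope \<dots>"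
    by (intro polytope_Int_polyhedron polytope_X_set
        polyhedron_max_affine_sublevel[OF max_affine_f_model[OF sound]])
  ultimately have "polytope Z"
    by (simp only:)
  have "m \<in> Z"
    using m level by (simp add: Z')
  then have "Z \<noteq> {}"
    by blast
  have "\<exists>x. is_analytic_center (\<Psi> Z) Z x"
    using \<open>polytope Z\<close> \<open>Z \<noteq> {}\<close> barrier
    by (intro analytic_center_exists polytope_imp_compact polytope_imp_convex)
  moreover have "rel_interior Z \<subseteq> rel_interior X"
    using polytope_imp_convex[OF \<open>polytope Z\<close>] m level unfolding Z'
    by (intro sublevel_rel_interior_subset[of _ _ _ m] convex_X max_affine_continuous
        max_affine_f_model[OF sound]) auto
  ultimately show ?thesis
    using that u(1) gap u(2) x Z' by blast
qed

text \<open>If an iteration finds no new violated contingency, then \<open>\<sigma> = 0\<close>, and \<open>u\<close> is at most the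
  objective with the current contingency sets at the current point.  The new cuts touch that objective there and descend along \<open>X\<close> with
  bounded slope only.\<close>

lemma stable_iteration_cut:
  assumes s: "good_state s" "cur s \<in> rel_interior X"
    and it: "iteration D xhat s h J L (ereal u) inc" and stable: "J = conts s"
    and lip: "\<And>w. (M w)-lipschitz_on X (week_cost w (J w))" and x: "x \<in> X"
  shows "u - (norm (cost_inv D) + (\<Sum>w\<in>UNIV. M w)) * dist x (cur s) \<le> f_model D h x"
proof -
  obtain y \<theta> g \<sigma> J' where
    or: "\<And>w. oracle_rel D xhat (cur s) w (conts s w) (y w) (\<theta> w) (g w) (\<sigma> w) (J' w)"
    and h: "h = (\<lambda>w x. max (model s w x) (\<theta> w + g w \<bullet> (x - cur s)))"
    and J: "J = (\<lambda>w. conts s w \<union> J' w)"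
    and U: "ereal u = min (upper s) (ereal (cost_inv D \<bullet> cur s + (\<Sum>w\<in>UNIV. \<theta> w + \<sigma> w)))"
    by (rule iterationE[OF it]) (rule that)
  have sub: "\<And>w. J w \<subseteq> J_full D"
    using s(1) stable by (simp add: sound_def)
  have "J' w = {}" for w
  proof -
    have "J' w \<subseteq> conts s w"
      using J stable by (metis Un_upper2)
    then show ?thesis
      using or[of w] by (auto simp: oracle_rel_def)
  qed
  then have "\<sigma> w = 0" for w
    using or[of w] by (simp add: oracle_rel_def)
  then have u: "u \<le> cost_inv D \<bullet> cur s + (\<Sum>w\<in>UNIV. \<theta> w)"
    using U by (metis (no_types, lifting) add.right_neutral ereal_less_eq(3) min.cobounded2 sum.cong)
  have "\<theta> w - M w * dist x (cur s) \<le> h w x" for w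
  proof -
    have "- (M w * dist x (cur s)) \<le> g w \<bullet> (x - cur s)"
    proof (rule cut_slope_bound[OF convex_X s(2) x])
      show "h_r D xhat z w (J w) = ereal (week_cost w (J w) z)" if "z \<in> X" for z
        by (rule h_r_eq_week_cost[OF that sub])
      show "g w \<in> subdifferential (\<lambda>x. h_r D xhat x w (J w)) (cur s)"
        using or[of w] stable by (simp add: oracle_rel_def)
    qed (fact lip)
    then show ?thesis by (simp add: h)
  qed
  then have "(\<Sum>w\<in>UNIV. \<theta> w) - (\<Sum>w\<in>UNIV. M w) * dist x (cur s) \<le> (\<Sum>w\<in>UNIV. h w x)"
    unfolding sum_distrib_right sum_subtractf[symmetric] by (intro sum_mono)
  moreover have "cost_inv D \<bullet> cur s - norm (cost_inv D) * dist x (cur s) \<le> cost_inv D \<bullet> x"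
    using norm_cauchy_schwarz[of "cost_inv D" "cur s - x"]
    by (simp add: inner_diff_right dist_norm norm_minus_commute)
  ultimately show ?thesis
    using u by (simp add: f_model_def algebra_simps)
qed

lemma iteration_monotone:
  assumes "iteration D xhat s h J L U inc"
  shows "U \<le> upper s" "model s w x \<le> h w x" "conts s w \<subseteq> J w"
  using assms by (auto simp: iteration_def Let_def)

lemma f_model_mono:
  assumes "\<And>w. h w x \<le> h' w x"
  shows "f_model D h x \<le> f_model D h' x"
  using assms unfolding f_model_def by (intro add_left_mono sum_mono)

end

section \<open>Progress and termination\<close>

locale bundle_method = bundle_problem D xhat
  for D :: "('n::finite,'br::finite,'dc::finite,'g::finite,'es::finite,'ld::finite,'uc::finite,
      'hy::finite,'hu::finite,'w::{finite,linorder}) data"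
    and xhat :: "real^'br" +
  fixes \<epsilon> \<alpha> :: real
    and x1 :: "('g,'es,'br,'hy,'w) fst_stage"
    and \<Psi> :: "('g,'es,'br,'hy,'w) fst_stage set \<Rightarrow> ('g,'es,'br,'hy,'w) fst_stage \<Rightarrow> real"
  assumes barrier: "\<And>Z. polytope Z \<Longrightarrow> Z \<noteq> {} \<Longrightarrow> self_concordant_barrier Z (\<Psi> Z)"
    and eps_pos: "0 < \<epsilon>" and alpha: "0 < \<alpha>" "\<alpha> < 1"
    and x1: "x1 \<in> X_set D"
begin

abbreviation bundle_step where "bundle_step \<equiv> step D xhat \<epsilon> \<alpha> \<Psi>"

definition good_config where
  "good_config c \<longleftrightarrow> (case c of
     Running s \<Rightarrow> good_state s
   | Returned x y \<Rightarrow> eps_optimal D xhat \<epsilon> x \<and> (\<forall>w. \<exists>J\<subseteq>J_full D. y w \<in> Y_set D xhat x w J))"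

lemma good_start: "good_config (start x1)"
proof -
  have "0 \<le> week_cost w (J_full D) x" for w x
    unfolding week_cost_def using h_r_nonneg[OF nonneg order_refl] by (rule real_of_ereal_pos)
  then show ?thesis
    using x1 max_affine_affine[of UNIV 0 0] by (simp add: good_config_def start_def sound_def)
qed

lemma good_step:
  assumes "bundle_step c c'" "good_config c"
  shows "good_config c'"
  using assms(1)
proof cases
  case (stop s h J L U x y)
  then show ?thesis
    using stop_eps_optimal[of s h J L U x y \<epsilon>] assms(2) by (simp add: good_config_def)
next
  case (continue s h J L U inc Z x')
  have s: "good_state s"
    using assms(2) continue by (simp add: good_config_def)
  have "x' \<in> X"
    using continue rel_interior_subset[of Z]
    by (auto simp: is_analytic_center_def is_arg_max_def)
  then show ?thesis
    using iteration_sound[OF s] continue by (simp add: good_config_def)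
qed

lemma progress:
  assumes "good_state s"
  shows "\<exists>c'. bundle_step (Running s) c'"
proof -
  obtain h J L U inc where it: "iteration D xhat s h J L U inc"
    using iteration_exists[OF assms] by blast
  show ?thesis
  proof (cases "(U - ereal L) / U < ereal \<epsilon>")
    case True
    obtain x y where "inc = Some (x, y)"
      using iteration_sound[OF assms it] by auto
    with it True show ?thesis
      using step.stop by blast
  next
    case False
    then obtain x' where "is_analytic_center
        (\<Psi> {x \<in> X. ereal (f_model D h x) \<le> ereal L + ereal \<alpha> * (U - ereal L)})
        {x \<in> X. ereal (f_model D h x) \<le> ereal L + ereal \<alpha> * (U - ereal L)} x'"
      using level_set_center[OF assms it False eps_pos alpha(1) barrier refl] by metis
    with it False show ?thesis
      using step.continue by blast
  qed
qed

lemma running_step: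
  assumes "bundle_step (Running s) (Running s')" "good_state s"
  obtains L u where "iteration D xhat s (model s') (conts s') L (upper s') (incumbent s')"
    "upper s' = ereal u" "\<epsilon> * u \<le> u - L" "\<exists>x\<in>X. F x \<le> u"
    "cur s' \<in> rel_interior X" "f_model D (model s') (cur s') \<le> L + \<alpha> * (u - L)"
  using assms(1)
proof cases
  case (continue h J L U inc Z x')
  obtain u where u: "U = ereal u" "\<epsilon> * u \<le> u - L" "\<exists>x\<in>X. F x \<le> u"
    "Z = {x \<in> X. f_model D h x \<le> L + \<alpha> * (u - L)}" "rel_interior Z \<subseteq> rel_interior X"
    by (rule level_set_center[OF assms(2) continue(2,3) eps_pos alpha(1) barrier continue(4)])
  have "x' \<in> rel_interior Z"
    using continue(5) by (simp add: is_analytic_center_def is_arg_max_def)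
  then show ?thesis
    using that[of L u] u continue(1,2) rel_interior_subset[of Z] by auto
qed

text \<open>Any two iterates \<open>v i\<close> and \<open>v k\<close> of the stable phase are separated: the model in iteration \<open>k\<close>
  contains the cut made at \<open>v i\<close>, whose value at \<open>v k\<close> would be at least nearly the upper bound if
  \<open>v k\<close> were close to \<open>v i\<close>, whereas \<open>v k\<close> was chosen at a level a fixed fraction of the gap below the upper bound.\<close>

lemma no_infinite_run:
  "\<nexists>C. C 0 = start x1 \<and> (\<forall>k. bundle_step (C k) (C (Suc k)))"
proof
  assume "\<exists>C. C 0 = start x1 \<and> (\<forall>k. bundle_step (C k) (C (Suc k)))"
  then obtain C where C0: "C 0 = start x1" and C: "\<And>k. bundle_step (C k) (C (Suc k))"
    by blast
  have "\<exists>s. C k = Running s" for k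
    using C[of k] by (auto elim: step.cases)
  then obtain S where S: "\<And>k. C k = Running (S k)"
    by metis
  have good: "good_state (S k)" for k
  proof -
    have "good_config (C k)"
      by (induction k) (auto simp: C0 good_start intro: good_step C)
    then show ?thesis
      by (simp add: S good_config_def)
  qed
  have "\<exists>L u. iteration D xhat (S k) (model (S (Suc k))) (conts (S (Suc k))) L
         (upper (S (Suc k))) (incumbent (S (Suc k))) \<and>
       upper (S (Suc k)) = ereal u \<and> \<epsilon> * u \<le> u - L \<and> (\<exists>x\<in>X. F x \<le> u) \<and>
       cur (S (Suc k)) \<in> rel_interior X \<and>
       f_model D (model (S (Suc k))) (cur (S (Suc k))) \<le> L + \<alpha> * (u - L)" for k
    using C[of k] unfolding S by (rule running_step[OF _ good]) blast
  then obtain L u where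
    it: "\<And>k. iteration D xhat (S k) (model (S (Suc k))) (conts (S (Suc k))) (L k)
         (upper (S (Suc k))) (incumbent (S (Suc k)))" and
    upper: "\<And>k. upper (S (Suc k)) = ereal (u k)" and gap: "\<And>k. \<epsilon> * u k \<le> u k - L k" and
    uF: "\<And>k. \<exists>x\<in>X. F x \<le> u k" and inner: "\<And>k. cur (S (Suc k)) \<in> rel_interior X" and
    level: "\<And>k. f_model D (model (S (Suc k))) (cur (S (Suc k))) \<le> L k + \<alpha> * (u k - L k)"
    by metis
  have u_decreasing: "u k \<le> u i" if "i \<le> k" for i k
  proof -
    have "decseq (\<lambda>k. upper (S k))"
      using iteration_monotone(1)[OF it] by (simp add: decseq_Suc_iff)
    from decseqD[OF this, of "Suc i" "Suc k"] show ?thesis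
      using that by (simp add: upper)
  qed
  have model_increasing: "model (S i) w x \<le> model (S k) w x" if "i \<le> k" for i k w x
    using lift_Suc_mono_le[of "\<lambda>k. model (S k) w x"] iteration_monotone(2)[OF it] that by blast
  define A where "A k = (SIGMA w:UNIV. conts (S k) w)" for k
  have "\<exists>k0. \<forall>k\<ge>k0. A k = A k0"
  proof (rule eventually_constant_in_finite)
    show "finite ((UNIV :: 'w set) \<times> J_full D)"
      by (simp add: finite_J_full)
    show "A k \<subseteq> UNIV \<times> J_full D" for k
      using good[of k] by (auto simp: A_def sound_def)
    show "A k \<subseteq> A (Suc k)" for k
      using iteration_monotone(3)[OF it] by (auto simp: A_def)
  qed
  then obtain k0 where k0: "\<forall>k\<ge>k0. A k = A k0" ..
  have stable: "conts (S k) = conts (S k0)" if "k0 \<le> k" for k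
  proof
    fix w
    have "A k = A k0"
      using k0 that by blast
    then show "conts (S k) w = conts (S k0) w"
      by (auto simp: A_def set_eq_iff)
  qed
  have "\<exists>M. M-lipschitz_on X (week_cost w (conts (S k0) w))" for w
  proof -
    have "conts (S k0) w \<subseteq> J_full D"
      using good[of k0] by (simp add: sound_def)
    then show ?thesis
      using max_affine_lipschitz[OF max_affine_week_cost] by blast
  qed
  then obtain M where M: "\<And>w. (M w)-lipschitz_on X (week_cost w (conts (S k0) w))"
    by metis
  \<comment> \<open>bounds the descent along \<open>X\<close> of the investment cost and the cuts of all weeks together\<close>
  define M' where "M' = norm (cost_inv D) + (\<Sum>w\<in>UNIV. M w)"
  have "0 \<le> M'"
    using lipschitz_on_nonneg[OF M] by (simp add: M'_def sum_nonneg)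
  have "X \<noteq> {}"
    using x1 by blast
  then obtain \<delta> where "0 < \<delta>" and \<delta>: "\<And>x. x \<in> X \<Longrightarrow> \<delta> \<le> F x"
    by (rule F_bounded_below) blast
  define \<gamma> where "\<gamma> = (1 - \<alpha>) * (\<epsilon> * \<delta>)"
  have "0 < \<gamma>"
    using alpha(2) eps_pos \<open>0 < \<delta>\<close> by (simp add: \<gamma>_def)
  \<comment> \<open>shifted by one, as the starting point need not be in the relative interior of \<open>X\<close>\<close>
  define v where "v n = cur (S (Suc (k0 + n)))" for n
  have separated: "\<gamma> \<le> M' * dist (v i) (v k)" if "i < k" for i k
  proof -
    \<comment> \<open>the cut is made at \<open>v i\<close> in iteration \<open>a\<close>; \<open>v k\<close> is the center chosen at the end of iteration \<open>b\<close>\<close>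
    define a b where "a = Suc (k0 + i)" and "b = k0 + k"
    have ab: "k0 \<le> a" "a \<le> b"
      using that by (simp_all add: a_def b_def)
    have stable': "conts (S (Suc a)) = conts (S a)" "conts (S (Suc a)) = conts (S k0)"
      using ab stable[of a] stable[of "Suc a"] by simp_all
    have "u a - M' * dist (cur (S (Suc b))) (cur (S a)) \<le>
        f_model D (model (S (Suc a))) (cur (S (Suc b)))"
      unfolding M'_def
    proof (rule stable_iteration_cut[OF good])
      show "cur (S a) \<in> rel_interior X"
        using inner by (simp add: a_def)
      show "iteration D xhat (S a) (model (S (Suc a))) (conts (S (Suc a))) (L a) (ereal (u a))
          (incumbent (S (Suc a)))"
        using it[of a] by (simp add: upper)
      show "(M w)-lipschitz_on X (week_cost w (conts (S (Suc a)) w))" for w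
        using M by (simp add: stable'(2))
      show "cur (S (Suc b)) \<in> X"
        using good by blast
    qed (fact stable'(1))
    also have "\<dots> \<le> f_model D (model (S (Suc b))) (cur (S (Suc b)))"
      using ab by (intro f_model_mono model_increasing) simp
    also have "\<dots> \<le> L b + \<alpha> * (u b - L b)"
      by (rule level)
    finally have "u b - (L b + \<alpha> * (u b - L b)) \<le> M' * dist (cur (S (Suc b))) (cur (S a))"
      using u_decreasing[OF ab(2)] by simp
    moreover have "\<gamma> \<le> (1 - \<alpha>) * (u b - L b)"
    proof -
      have "\<delta> \<le> u b"
        using uF[of b] \<delta> by force
      then have "\<epsilon> * \<delta> \<le> u b - L b"
        using gap[of b] eps_pos by (smt (verit) mult_left_mono)
      then show ?thesis
        unfolding \<gamma>_def using alpha(2) by (intro mult_left_mono) auto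
    qed
    ultimately show ?thesis
      by (simp add: v_def a_def b_def dist_commute algebra_simps)
  qed
  \<comment> \<open>division by \<open>M' + 1\<close> rather than \<open>M'\<close>, since \<open>M'\<close> may be zero\<close>
  obtain i k where "i < k" and close: "dist (v i) (v k) < \<gamma> / (M' + 1)"
    using no_separated_sequence_in_compact[OF compact_X, of v "\<gamma> / (M' + 1)"]
      good \<open>0 < \<gamma>\<close> \<open>0 \<le> M'\<close> by (auto simp: v_def)
  have "(M' + 1) * dist (v i) (v k) < \<gamma>"
    using close \<open>0 \<le> M'\<close> by (simp add: field_simps)
  then show False
    using separated[OF \<open>i < k\<close>] zero_le_dist[of "v i" "v k"] by (simp add: distrib_right)
qed

end

theorem proposition2:
  fixes D :: "('n::finite,'br::finite,'dc::finite,'g::finite,'es::finite,'ld::finite,'uc::finite,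
      'hy::finite,'hu::finite,'w::{finite,linorder}) data"
    and xhat :: "real^'br"
    and \<epsilon> \<alpha> :: real
    and x1 :: "('g,'es,'br,'hy,'w) fst_stage"
    and \<Psi> :: "('g,'es,'br,'hy,'w) fst_stage set \<Rightarrow> ('g,'es,'br,'hy,'w) fst_stage \<Rightarrow> real"
  assumes "valid_data D"
    and "nonneg_costs D"
    and "complete_recourse D xhat"
    and "\<And>x. x \<in> X_set D \<Longrightarrow> 0 < F_obj D xhat x"
    and "\<And>Z. polytope Z \<Longrightarrow> Z \<noteq> {} \<Longrightarrow> self_concordant_barrier Z (\<Psi> Z)"
    and "0 < \<epsilon>" and "0 < \<alpha>" and "\<alpha> < 1"
    and "x1 \<in> X_set D"
  shows "(\<nexists>C. C 0 = start x1 \<and> (\<forall>k. step D xhat \<epsilon> \<alpha> \<Psi> (C k) (C (Suc k)))) \<and>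
    (\<forall>c. (step D xhat \<epsilon> \<alpha> \<Psi>)\<^sup>*\<^sup>* (start x1) c \<longrightarrow>
       (\<exists>c'. step D xhat \<epsilon> \<alpha> \<Psi> c c') \<or>
       (\<exists>xs ys. c = Returned xs ys \<and> eps_optimal D xhat \<epsilon> xs \<and>
          (\<forall>w. \<exists>J\<subseteq>J_full D. ys w \<in> Y_set D xhat xs w J)))"
proof -
  interpret bundle_method D xhat \<epsilon> \<alpha> x1 \<Psi>
    using assms by unfold_locales
  have good: "good_config c" if "bundle_step\<^sup>*\<^sup>* (start x1) c" for c
    using that by induction (auto intro: good_start good_step)
  have "(\<exists>c'. bundle_step c c') \<or>
       (\<exists>xs ys. c = Returned xs ys \<and> eps_optimal D xhat \<epsilon> xs \<and>
          (\<forall>w. \<exists>J\<subseteq>J_full D. ys w \<in> Y_set D xhat xs w J))"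
    if "bundle_step\<^sup>*\<^sup>* (start x1) c" for c
    using good[OF that] progress by (cases c) (auto simp: good_config_def)
  with no_infinite_run show ?thesis
    by blast
qed

end
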